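(* Let $Y_1,Y_2,Y_3,P_1,P_2,P_3$ be the shear coordinates of the sphere $\Sigma_{0,4}$ with four holes, with their Poisson bracket, and let $\gamma_1,\gamma_2,\gamma_3$ be the corresponding generators of the Fuchsian group $\Delta_{0,4}$ (all defined in the context). Put $G_i=-\mathrm{Tr}(\gamma_i)$ for $i=1,2,3$, $G_\infty=-\mathrm{Tr}(\gamma_1\gamma_2\gamma_3)$, and $$G_{i,j}:=-\mathrm{Tr}(\gamma_i\gamma_j),\qquad 1\le i<j\le 3,\qquad \omega_{i,j}:=G_iG_j+G_kG_\infty,\quad \{i,j,k\}=\{1,2,3\}.$$ (1) The Poisson algebra of geodesic functions on the sphere with four holes is generated, over the central elements $G_1,G_2,G_3,G_\infty$, by the three elements $G_{1,2},G_{2,3},G_{1,3}$ (which correspond to closed paths without self-intersections encircling two holes), and their Poisson brackets are $$\{G_{1,2},G_{2,3}\}=G_{1,2}G_{2,3}-2G_{1,3}-\omega_{1,3},$$ $$\{G_{2,3},G_{1,3}\}=G_{2,3}G_{1,3}-2G_{1,2}-\omega_{1,2},$$ $$\{G_{1,3},G_{1,2}\}=G_{1,2}G_{1,3}-2G_{2,3}-\omega_{2,3}.$$ (2) For any choice of constants $\omega_{1,2},\omega_{2,3},\omega_{1,3}$, these three formulae define an abstract Poisson algebra on the polynomial algebra in three indeterminates $G_{1,2},G_{2,3},G_{1,3}$, i.e. the Jacobi identity is satisfied; and the element $$\mathcal C=G_{1,2}^2+G_{2,3}^2+G_{1,3}^2-G_{1,2}G_{2,3}G_{1,3}+G_{1,2}\,\omega_{1,2}+G_{2,3}\,\omega_{2,3}+G_{1,3}\,\omega_{1,3}$$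 is a central element of it.
   Context: Matrices: $R=\begin{pmatrix}1&1\\ -1&0\end{pmatrix}$, $L=\begin{pmatrix}0&1\\ -1&-1\end{pmatrix}$, and $X_Z=\begin{pmatrix}0&-e^{Z/2}\\ e^{-Z/2}&0\end{pmatrix}$ for $Z\in\mathbb R$. Shear coordinates for the four-holed sphere: the fat graph (trivalent spine) is the three-petal graph, with a central trivalent vertex at which edges labelled $Y_1,Y_2,Y_3$ meet in this counterclockwise cyclic order, the other end of edge $Y_i$ being attached to a loop edge labelled $P_i$. The real coordinates $Y_1,Y_2,Y_3,P_1,P_2,P_3$ carry the bracket $$\{f,g\}=\sum_{\text{vertices }\alpha}\ \sum_{i=1}^{3}\left(\frac{\partial f}{\partial Z_{\alpha_i}}\frac{\partial g}{\partial Z_{\alpha_{i+1}}}-\frac{\partial g}{\partial Z_{\alpha_i}}\frac{\partial f}{\partial Z_{\alpha_{i+1}}}\right),$$ where $\alpha_1,\alpha_2,\alpha_3$ ($\alpha_4\equiv\alpha_1$) are the counterclockwise ordered edges at the vertex $\alpha$. For this graph this means $\{Y_1,Y_2\}=\{Y_2,Y_3\}=\{Y_3,Y_1\}=1$, and each $P_i$ Poisson-commutes with all coordinates. Generators of the Fuchsian group $\Delta_{0,4}$ (the fundamental group of $\Sigma_{0,4}$, a free group on $\gamma_1,\gamma_2,\gamma_3$): $$\gamma_1=X_{Y_1}RX_{P_1}RX_{Y_1},\qquad \gamma_2=-RX_{Y_2}RX_{P_2}RX_{Y_2}L,\qquad \gamma_3=-LX_{Y_3}RX_{P_3}RX_{Y_3}R,$$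 where $X_{Y_i}RX_{P_i}RX_{Y_i}=\begin{pmatrix}0&-e^{Y_i+P_i/2}\\ e^{-Y_i-P_i/2}&-e^{-P_i/2}-e^{P_i/2}\end{pmatrix}$. Geodesic functions: for $\gamma\in\Delta_{0,4}$, the geodesic function of the corresponding closed geodesic of length $\ell_\gamma$ is $e^{\ell_\gamma/2}+e^{-\ell_\gamma/2}$, which equals $\mathrm{Tr}\,\gamma$ up to sign. The algebra of geodesic functions is the algebra of functions of the shear coordinates generated by all $\mathrm{Tr}\,\gamma$, $\gamma\in\Delta_{0,4}$, with the Poisson bracket on functions of the shear coordinates determined by $\{Y_1,Y_2\}=\{Y_2,Y_3\}=\{Y_3,Y_1\}=1$ and each $P_i$ Poisson-commuting with all coordinates. "Central" means Poisson-commuting with every element of the algebra. *)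

theory Defs
  imports
    "HOL-Analysis.Analysis"
    "HOL-Library.Function_Algebras"
    "HOL-Library.Poly_Mapping"
begin

text \<open>
  All indices \<open>i = 1, 2, 3\<close> live in the type \<^typ>\<open>3\<close> of residues modulo 3, where
  \<open>3 = 0\<close> and \<open>i + 1\<close> is the cyclic successor.  Functions of the shear coordinates form a
  commutative ring under the pointwise operations of Function_Algebras.
\<close>


text \<open>
  \<open>generated_algebra K S\<close> is the algebra generated by \<open>S\<close> over the coefficient ring \<open>K\<close>, both
  taken inside one ambient commutative ring; \<open>K\<close> is always a subring containing \<open>1\<close> (it
  contains \<open>-1\<close>, so the result is closed under negation).
\<close>

inductive_set generated_algebra :: "'a::comm_ring_1 set \<Rightarrow> 'a set \<Rightarrow> 'a set"
  for K S :: "'a set" where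
  coeff: "c \<in> K \<Longrightarrow> c \<in> generated_algebra K S"
| gen: "x \<in> S \<Longrightarrow> x \<in> generated_algebra K S"
| add: "x \<in> generated_algebra K S \<Longrightarrow> y \<in> generated_algebra K S \<Longrightarrow> x + y \<in> generated_algebra K S"
| mult: "x \<in> generated_algebra K S \<Longrightarrow> y \<in> generated_algebra K S \<Longrightarrow> x * y \<in> generated_algebra K S"

definition skew_biderivation_on ::
    "'a::comm_ring_1 set \<Rightarrow> 'a set \<Rightarrow> ('a \<Rightarrow> 'a \<Rightarrow> 'a) \<Rightarrow> bool" where
  "skew_biderivation_on K A br \<longleftrightarrow>
     (\<forall>f\<in>A. \<forall>g\<in>A. br f g \<in> A) \<and>
     (\<forall>f\<in>A. \<forall>g\<in>A. br f g = - br g f) \<and>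
     (\<forall>f\<in>A. \<forall>g\<in>A. \<forall>h\<in>A. br (f + g) h = br f h + br g h) \<and>
     (\<forall>c\<in>K. \<forall>f\<in>A. \<forall>g\<in>A. br (c * f) g = c * br f g) \<and>
     (\<forall>f\<in>A. \<forall>g\<in>A. \<forall>h\<in>A. br (f * g) h = f * br g h + br f h * g)"

definition jacobi_on :: "'a::comm_ring_1 set \<Rightarrow> ('a \<Rightarrow> 'a \<Rightarrow> 'a) \<Rightarrow> bool" where
  "jacobi_on A br \<longleftrightarrow>
     (\<forall>f\<in>A. \<forall>g\<in>A. \<forall>h\<in>A. br f (br g h) + br g (br h f) + br h (br f g) = 0)"

text \<open>The carrier \<open>A\<close> is understood to be a subalgebra over the subring \<open>K\<close> of scalars.\<close>

definition poisson_algebra_on ::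
    "'a::comm_ring_1 set \<Rightarrow> 'a set \<Rightarrow> ('a \<Rightarrow> 'a \<Rightarrow> 'a) \<Rightarrow> bool" where
  "poisson_algebra_on K A br \<longleftrightarrow> skew_biderivation_on K A br \<and> jacobi_on A br"

definition poisson_central :: "'a::zero set \<Rightarrow> ('a \<Rightarrow> 'a \<Rightarrow> 'a) \<Rightarrow> 'a \<Rightarrow> bool" where
  "poisson_central A br c \<longleftrightarrow> c \<in> A \<and> (\<forall>f\<in>A. br c f = 0)"


text \<open>
  The edges of the three-petal fat graph: \<open>Yedge i\<close> joins the centre to the loop \<open>Pedge i\<close>.
\<close>

datatype edge = Yedge 3 | Pedge 3

instance edge :: finite
proof
  have "(UNIV :: edge set) = range Yedge \<union> range Pedge"
    by (metis UNIV_eq_I UnI1 UnI2 edge.exhaust rangeI)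
  then show "finite (UNIV :: edge set)"
    by (metis finite_UnI finite_class.finite_UNIV finite_imageI)
qed

type_synonym shear = "real ^ edge"

text \<open>
  A vertex is its cyclic list \<open>\<alpha>\<^sub>1, \<alpha>\<^sub>2, \<alpha>\<^sub>3\<close> of counterclockwise ordered edges, as a function of
  the residue.  At the outer end of \<open>Yedge j\<close> both half-edges of the loop \<open>Pedge j\<close> meet.
\<close>

definition vertices :: "(3 \<Rightarrow> edge) set" where
  "vertices = insert Yedge (range (\<lambda>j i. if i = 1 then Yedge j else Pedge j))"

text \<open>Only meaningful for differentiable functions, as \<^const>\<open>deriv\<close> is total.\<close>

definition partial :: "edge \<Rightarrow> (shear \<Rightarrow> real) \<Rightarrow> shear \<Rightarrow> real" where
  "partial e f z = deriv (\<lambda>t. f (z + t *\<^sub>R axis e 1)) 0"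

definition shear_bracket :: "(shear \<Rightarrow> real) \<Rightarrow> (shear \<Rightarrow> real) \<Rightarrow> shear \<Rightarrow> real" where
  "shear_bracket f g z =
     (\<Sum>\<alpha>\<in>vertices. \<Sum>i\<in>UNIV.
        partial (\<alpha> i) f z * partial (\<alpha> (i + 1)) g z
        - partial (\<alpha> i) g z * partial (\<alpha> (i + 1)) f z)"


text \<open>The outer vertices cancel, which gives the bracket its usual description on coordinates.\<close>

lemma shear_bracket_expand:
  "shear_bracket f g z =
     (\<Sum>i\<in>UNIV. partial (Yedge i) f z * partial (Yedge (i + 1)) g z
              - partial (Yedge i) g z * partial (Yedge (i + 1)) f z)"
proof -
  define v where "v = (\<lambda>(j::3) (i::3). if i = 1 then Yedge j else Pedge j)"
  define B where "B = (\<lambda>\<alpha>::3\<Rightarrow>edge. \<Sum>i\<in>UNIV.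
        partial (\<alpha> i) f z * partial (\<alpha> (i + 1)) g z
        - partial (\<alpha> i) g z * partial (\<alpha> (i + 1)) f z)"
  have "B (v j) = 0" for j
    by (simp add: B_def v_def sum_3)
  moreover have "Yedge \<notin> range v"
    by (auto simp: v_def fun_eq_iff)
       (metis edge.distinct(1) one_neq_zero)
  ultimately have "sum B (insert Yedge (range v)) = B Yedge"
    by (subst sum.insert) (auto intro!: sum.neutral)
  then show ?thesis
    unfolding shear_bracket_def vertices_def B_def v_def .
qed

lemma partial_coord: "partial e (\<lambda>z. z $ e') z = (if e = e' then 1 else 0)"
proof -
  have "((\<lambda>t. (z + t *\<^sub>R axis e 1) $ e') has_real_derivative (if e = e' then 1 else 0)) (at 0)"
    by (auto simp: axis_def intro!: derivative_eq_intros)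
  then show ?thesis unfolding partial_def by (rule DERIV_imp_deriv)
qed

lemma coordinate_brackets:
  "shear_bracket (\<lambda>z. z $ Yedge i) (\<lambda>z. z $ Yedge (i + 1)) = 1"
  "shear_bracket (\<lambda>z. z $ Pedge i) (\<lambda>z. z $ e) = 0"
  using exhaust_3[of i]
  by (auto simp: fun_eq_iff shear_bracket_expand partial_coord sum_3)


definition matR :: "real^2^2" where
  "matR = vector [vector [1, 1], vector [-1, 0]]"

definition matL :: "real^2^2" where
  "matL = vector [vector [0, 1], vector [-1, -1]]"

definition matX :: "real \<Rightarrow> real^2^2" where
  "matX Z = vector [vector [0, - exp (Z / 2)], vector [exp (- (Z / 2)), 0]]"

definition petal :: "3 \<Rightarrow> shear \<Rightarrow> real^2^2" where
  "petal i z = matX (z $ Yedge i) ** matR ** matX (z $ Pedge i) ** matR ** matX (z $ Yedge i)"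

definition gamma :: "3 \<Rightarrow> shear \<Rightarrow> real^2^2" where
  "gamma i z =
     (if i = 1 then petal 1 z
      else if i = 2 then - (matR ** petal 2 z ** matL)
      else - (matL ** petal 3 z ** matR))"

text \<open>
  An element of the Fuchsian group is a word in the generators, viewed as a matrix-valued
  function of the shear coordinates.
\<close>

inductive_set Delta04 :: "(shear \<Rightarrow> real^2^2) set" where
  one: "(\<lambda>z. mat 1) \<in> Delta04"
| gen: "gamma i \<in> Delta04"
| mult: "A \<in> Delta04 \<Longrightarrow> B \<in> Delta04 \<Longrightarrow> (\<lambda>z. A z ** B z) \<in> Delta04"
| inv: "A \<in> Delta04 \<Longrightarrow> (\<lambda>z. matrix_inv (A z)) \<in> Delta04"

definition const_funs :: "(shear \<Rightarrow> real) set" where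
  "const_funs = range (\<lambda>c z. c)"

definition geodesic_algebra :: "(shear \<Rightarrow> real) set" where
  "geodesic_algebra = generated_algebra const_funs {\<lambda>z. trace (A z) | A. A \<in> Delta04}"

definition G :: "3 \<Rightarrow> shear \<Rightarrow> real" where
  "G i z = - trace (gamma i z)"

definition G_inf :: "shear \<Rightarrow> real" where
  "G_inf z = - trace (gamma 1 z ** gamma 2 z ** gamma 3 z)"

definition G_pair :: "3 \<Rightarrow> 3 \<Rightarrow> shear \<Rightarrow> real" where
  "G_pair i j z = - trace (gamma i z ** gamma j z)"

text \<open>As \<open>1 + 2 + 3 = 0\<close> modulo 3, the index complementary to \<open>i \<noteq> j\<close> is \<open>- i - j\<close>.\<close>

definition omega :: "3 \<Rightarrow> 3 \<Rightarrow> shear \<Rightarrow> real" where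
  "omega i j = G i * G j + G (- i - j) * G_inf"


text \<open>
  Polynomials over \<open>'k\<close> in three indeterminates: finitely supported maps from monomials, i.e.
  finitely supported exponent functions on the three labels, to coefficients.
\<close>

datatype label = L12 | L23 | L13

type_synonym 'k poly3 = "(label \<Rightarrow>\<^sub>0 nat) \<Rightarrow>\<^sub>0 'k"

definition indet :: "label \<Rightarrow> 'k::comm_ring_1 poly3" where
  "indet l = Poly_Mapping.single (Poly_Mapping.single l 1) 1"

definition const_poly :: "'k::comm_ring_1 \<Rightarrow> 'k poly3" where
  "const_poly c = Poly_Mapping.single 0 c"

end

theory Submission
  imports Defs
begin

text \<open>
  With \<open>s\<^sub>i = exp (Y\<^sub>i + P\<^sub>i / 2)\<close> and \<open>p\<^sub>i = 2 cosh (P\<^sub>i / 2)\<close>, every trace in sight is a Laurent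
  polynomial in the \<open>s\<^sub>i\<close> with coefficients polynomial in the \<open>p\<^sub>i\<close>, and the bracket formulae
  become identities of rational functions.  Generation is the Fricke argument: by Cayley-Hamilton,
  \<open>BA\<close> is a combination of \<open>AB\<close>, \<open>A\<close>, \<open>B\<close>, \<open>1\<close> with coefficients polynomial in traces, so the span
  of the eight ordered products of the generators is closed under multiplication.  The Jacobiator
  and the bracket with \<open>\<C>\<close> are derivations in each argument, hence vanish once they vanish on
  the three generators; this is used both for the abstract algebra and, with the algebra generated
  by \<open>G\<^sub>1, G\<^sub>2, G\<^sub>3, G\<^sub>\<infinity>\<close> as scalars, for geodesic functions.
\<close>

section \<open>Poisson brackets on generated algebras\<close>

definition derivation_on :: "'a::comm_ring_1 set \<Rightarrow> ('a \<Rightarrow> 'a) \<Rightarrow> bool" where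
  "derivation_on A d \<longleftrightarrow>
     (\<forall>f\<in>A. \<forall>g\<in>A. d (f + g) = d f + d g) \<and>
     (\<forall>f\<in>A. \<forall>g\<in>A. d (f * g) = f * d g + d f * g)"

text \<open>The kernel of a derivation is closed under sums and products, so once it contains
  \<open>K\<close> and \<open>S\<close> it contains everything they generate.\<close>

lemma derivation_on_vanishes:
  assumes "derivation_on (generated_algebra K S) d"
    and "\<And>c. c \<in> K \<Longrightarrow> d c = 0" and "\<And>s. s \<in> S \<Longrightarrow> d s = 0"
    and "f \<in> generated_algebra K S"
  shows "d f = 0"
  using assms(4)
  by induction (use assms(1-3) in \<open>simp_all add: derivation_on_def\<close>)

lemma generated_algebra_uminus:
  assumes "- 1 \<in> K" "f \<in> generated_algebra K S"
  shows "- f \<in> generated_algebra K S"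
  using generated_algebra.mult[OF generated_algebra.coeff[OF assms(1)] assms(2)] by simp

lemma generated_algebra_diff:
  assumes "- 1 \<in> K" "f \<in> generated_algebra K S" "g \<in> generated_algebra K S"
  shows "f - g \<in> generated_algebra K S"
  using generated_algebra.add[OF assms(2) generated_algebra_uminus[OF assms(1,3)]] by simp

lemma generated_algebra_power:
  assumes "1 \<in> K" "f \<in> generated_algebra K S"
  shows "f ^ n \<in> generated_algebra K S"
  by (induction n) (use assms in \<open>auto intro: generated_algebra.intros\<close>)

lemma generated_algebra_two:
  assumes "1 \<in> K" "f \<in> generated_algebra K S"
  shows "2 * f \<in> generated_algebra K S"
  unfolding mult_2 using assms(2) by (rule generated_algebra.add[OF _ assms(2)])

lemma generated_algebra_subset:
  assumes "K \<subseteq> generated_algebra K' S'" "S \<subseteq> generated_algebra K' S'"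
  shows "generated_algebra K S \<subseteq> generated_algebra K' S'"
proof
  fix f assume "f \<in> generated_algebra K S"
  then show "f \<in> generated_algebra K' S'"
    by induction (use assms in \<open>auto intro: generated_algebra.intros\<close>)
qed

text \<open>Closure of \<open>A\<close> under the bracket reduces to pairs of generators: the
  Leibniz rule propagates it in the left slot, skew-symmetry carries it to the right slot. Linearity
  over \<open>K\<close> is the Leibniz rule for a factor whose brackets vanish.\<close>

lemma skew_biderivation_onI:
  fixes K S defines "A \<equiv> generated_algebra K S"
  assumes skew: "\<And>f g. f \<in> A \<Longrightarrow> g \<in> A \<Longrightarrow> br f g = - br g f"
    and br_add: "\<And>f g h. f \<in> A \<Longrightarrow> g \<in> A \<Longrightarrow> h \<in> A \<Longrightarrow> br (f + g) h = br f h + br g h"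
    and br_mult: "\<And>f g h. f \<in> A \<Longrightarrow> g \<in> A \<Longrightarrow> h \<in> A \<Longrightarrow> br (f * g) h = f * br g h + br f h * g"
    and scalar: "\<And>c f. c \<in> K \<Longrightarrow> f \<in> A \<Longrightarrow> br c f = 0"
    and gens: "\<And>s t. s \<in> S \<Longrightarrow> t \<in> S \<Longrightarrow> br s t \<in> A"
    and K: "0 \<in> K" "- 1 \<in> K"
  shows "skew_biderivation_on K A br"
proof -
  have closed_left: "br f g \<in> A" if "f \<in> A" "g \<in> A" "\<And>s. s \<in> S \<Longrightarrow> br s g \<in> A" for f g
    using that(1) unfolding A_def
  proof induction
    case (coeff c)
    then show ?case using scalar[OF coeff that(2)] K by (simp add: generated_algebra.coeff)
  next
    case (gen x)
    then show ?case using that(3) by (simp add: A_def)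
  next
    case (add x y)
    then show ?case using br_add[of x y g] that(2) by (auto simp: A_def intro: generated_algebra.add)
  next
    case (mult x y)
    then show ?case using br_mult[of x y g] that(2)
      by (auto simp: A_def intro: generated_algebra.add generated_algebra.mult)
  qed
  \<comment> \<open>Turning the bracket around puts the arbitrary element \<open>g\<close> into the
    slot where \<open>closed_left\<close> applies and leaves only brackets of generators.\<close>
  have "br s g \<in> A" if "s \<in> S" "g \<in> A" for s g
  proof -
    have s: "s \<in> A" using that by (simp add: A_def generated_algebra.gen)
    have "br g s \<in> A" using closed_left[OF that(2) s] gens that(1) by blast
    then show ?thesis
      using skew[OF s that(2)] generated_algebra_uminus[OF K(2)] by (simp add: A_def)
  qed
  then have "br f g \<in> A" if "f \<in> A" "g \<in> A" for f g using closed_left that by blast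
  moreover have "br (c * f) g = c * br f g" if "c \<in> K" "f \<in> A" "g \<in> A" for c f g
    using br_mult[of c f g] scalar[of c g] that by (simp add: A_def generated_algebra.coeff)
  ultimately show ?thesis
    unfolding skew_biderivation_on_def by (intro conjI ballI skew br_add br_mult)
qed

section \<open>Calculus of a skew biderivation on a generated algebra\<close>

locale skew_biderivation =
  fixes K S A :: "'a::comm_ring_1 set" and br :: "'a \<Rightarrow> 'a \<Rightarrow> 'a"
  assumes A_def: "A = generated_algebra K S"
    and biderivation: "skew_biderivation_on K A br"
    and one_K: "1 \<in> K" and minus_one_K: "- 1 \<in> K"
begin

lemma K_A: "c \<in> K \<Longrightarrow> c \<in> A"
  and S_A: "s \<in> S \<Longrightarrow> s \<in> A"
  and add_A: "f \<in> A \<Longrightarrow> g \<in> A \<Longrightarrow> f + g \<in> A"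
  and mult_A: "f \<in> A \<Longrightarrow> g \<in> A \<Longrightarrow> f * g \<in> A"
  and uminus_A: "f \<in> A \<Longrightarrow> - f \<in> A"
  and diff_A: "f \<in> A \<Longrightarrow> g \<in> A \<Longrightarrow> f - g \<in> A"
  and power_A: "f \<in> A \<Longrightarrow> f ^ n \<in> A"
  and two_A: "f \<in> A \<Longrightarrow> 2 * f \<in> A"
  by (simp_all add: A_def generated_algebra.intros generated_algebra_uminus generated_algebra_diff
      generated_algebra_power generated_algebra_two one_K minus_one_K)

lemma zero_A: "0 \<in> A"
  using add_A[OF K_A[OF one_K] K_A[OF minus_one_K]] by simp

lemmas closed_A = zero_A K_A S_A add_A mult_A uminus_A diff_A power_A two_A

lemma br_A: "f \<in> A \<Longrightarrow> g \<in> A \<Longrightarrow> br f g \<in> A"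
  and br_skew: "f \<in> A \<Longrightarrow> g \<in> A \<Longrightarrow> br f g = - br g f"
  and br_add_left: "f \<in> A \<Longrightarrow> g \<in> A \<Longrightarrow> h \<in> A \<Longrightarrow> br (f + g) h = br f h + br g h"
  and br_scale_left: "c \<in> K \<Longrightarrow> f \<in> A \<Longrightarrow> g \<in> A \<Longrightarrow> br (c * f) g = c * br f g"
  and br_mult_left: "f \<in> A \<Longrightarrow> g \<in> A \<Longrightarrow> h \<in> A \<Longrightarrow> br (f * g) h = f * br g h + br f h * g"
  using biderivation unfolding skew_biderivation_on_def by blast+

lemma br_add_right:
  assumes "f \<in> A" "g \<in> A" "h \<in> A"
  shows "br h (f + g) = br h f + br h g"
  using assms br_skew[of h "f + g"] br_skew[of h f] br_skew[of h g] br_add_left[of f g h]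
  by (simp add: add_A)

lemma br_mult_right:
  assumes "f \<in> A" "g \<in> A" "h \<in> A"
  shows "br h (f * g) = f * br h g + br h f * g"
  using assms br_skew[of h "f * g"] br_skew[of h f] br_skew[of h g] br_mult_left[of f g h]
  by (simp add: mult_A)

text \<open>The Leibniz rule for \<open>1 * 1\<close> gives \<open>br 1 f = br 1 f + br 1 f\<close>,
  so \<open>1\<close> is central, and linearity over \<open>K\<close> extends this to every
  scalar.\<close>

lemma br_scalar_left:
  assumes "c \<in> K" "f \<in> A"
  shows "br c f = 0"
proof -
  have "br 1 f = 0"
    using br_mult_left[of 1 1 f] assms by (simp add: K_A one_K)
  then show ?thesis
    using br_scale_left[of c 1 f] assms by (simp add: K_A one_K)
qed

lemma br_scalar_right: "c \<in> K \<Longrightarrow> f \<in> A \<Longrightarrow> br f c = 0"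
  using br_skew[of f c] br_scalar_left[of c f] by (simp add: K_A)

lemma br_zero_left: "f \<in> A \<Longrightarrow> br 0 f = 0"
  using br_add_left[of 0 0 f] by (simp add: zero_A)

lemma br_zero_right: "f \<in> A \<Longrightarrow> br f 0 = 0"
  using br_add_right[of 0 0 f] by (simp add: zero_A)

lemma br_uminus_left: "f \<in> A \<Longrightarrow> g \<in> A \<Longrightarrow> br (- f) g = - br f g"
  using br_mult_left[of "- 1" f g] br_scalar_left[of "- 1" g] by (simp add: K_A minus_one_K)

lemma br_uminus_right: "f \<in> A \<Longrightarrow> g \<in> A \<Longrightarrow> br g (- f) = - br g f"
  using br_mult_right[of "- 1" f g] br_scalar_right[of "- 1" g] by (simp add: K_A minus_one_K)

lemma br_diff_left:
  assumes "f \<in> A" "g \<in> A" "h \<in> A"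
  shows "br (f - g) h = br f h - br g h"
  using br_add_left[of f "- g" h] assms by (simp add: uminus_A br_uminus_left)

lemma br_diff_right:
  assumes "f \<in> A" "g \<in> A" "h \<in> A"
  shows "br h (f - g) = br h f - br h g"
  using br_add_right[of f "- g" h] assms by (simp add: uminus_A br_uminus_right)

lemma br_two_left: "f \<in> A \<Longrightarrow> g \<in> A \<Longrightarrow> br (2 * f) g = 2 * br f g"
  unfolding mult_2 by (rule br_add_left)

lemma br_two_right: "f \<in> A \<Longrightarrow> g \<in> A \<Longrightarrow> br g (2 * f) = 2 * br g f"
  unfolding mult_2 by (rule br_add_right)

lemmas br_simps =
  br_add_left br_add_right br_diff_left br_diff_right br_mult_left br_mult_right
  br_uminus_left br_uminus_right br_two_left br_two_right br_zero_left br_zero_right br_scalar_left br_scalar_right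

lemma br_vanishes:
  assumes "f \<in> A" "h \<in> A" "\<And>s. s \<in> S \<Longrightarrow> br s h = 0"
  shows "br f h = 0"
proof (rule derivation_on_vanishes[where d = "\<lambda>f. br f h" and K = K and S = S])
  show "derivation_on (generated_algebra K S) (\<lambda>f. br f h)"
    using assms(2) by (auto simp: derivation_on_def A_def[symmetric] br_simps)
qed (use assms in \<open>simp_all add: A_def[symmetric] br_simps\<close>)

section \<open>The Jacobiator and its reduction to generators\<close>

definition jacobiator :: "'a \<Rightarrow> 'a \<Rightarrow> 'a \<Rightarrow> 'a" where
  "jacobiator f g h = br f (br g h) + br g (br h f) + br h (br f g)"

lemma jacobiator_cycle: "jacobiator f g h = jacobiator g h f"
  by (simp add: jacobiator_def add_ac)

lemma jacobiator_swap:
  assumes "f \<in> A" "g \<in> A" "h \<in> A"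
  shows "jacobiator f h g = - jacobiator f g h"
  unfolding jacobiator_def
  using assms br_skew[of h g] br_skew[of g f] br_skew[of f h]
  by (simp add: br_A br_uminus_right)

text \<open>The summands with \<open>f\<close> in an inner bracket produce products of two brackets,
  such as \<open>br g f * br h f'\<close>, when \<open>f\<close> is replaced by a product. In the
  cyclic sum these cross terms cancel in pairs by skew-symmetry.\<close>

lemma jacobiator_derivation:
  assumes "g \<in> A" "h \<in> A"
  shows "derivation_on A (\<lambda>f. jacobiator f g h)"
proof -
  have "jacobiator (f * f') g h = f * jacobiator f' g h + jacobiator f g h * f'"
    if "f \<in> A" "f' \<in> A" for f f'
    unfolding jacobiator_def
    using that assms br_skew[of h f] br_skew[of h f'] br_skew[of g f] br_skew[of g f']
    by (simp add: br_simps closed_A br_A algebra_simps)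
  then show ?thesis
    using assms
    by (auto simp: derivation_on_def jacobiator_def br_simps closed_A br_A algebra_simps)
qed

lemma jacobiator_vanishes_left:
  assumes "f \<in> A" "g \<in> A" "h \<in> A" "\<And>s. s \<in> S \<Longrightarrow> jacobiator s g h = 0"
  shows "jacobiator f g h = 0"
proof (rule derivation_on_vanishes[where d = "\<lambda>f. jacobiator f g h" and K = K and S = S])
  show "derivation_on (generated_algebra K S) (\<lambda>f. jacobiator f g h)"
    using jacobiator_derivation[OF assms(2,3)] by (simp add: A_def)
  show "jacobiator c g h = 0" if "c \<in> K" for c
    using that assms by (simp add: jacobiator_def br_simps closed_A br_A)
qed (use assms A_def in auto)

text \<open>Cyclic rotation brings each argument in turn to the front, where the derivation property
  replaces a generator by an arbitrary element.\<close>

lemma jacobi_on_generators: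
  assumes "\<And>r s t. r \<in> S \<Longrightarrow> s \<in> S \<Longrightarrow> t \<in> S \<Longrightarrow> jacobiator r s t = 0"
  shows "jacobi_on A br"
proof -
  have 1: "jacobiator f s t = 0" if "f \<in> A" "s \<in> S" "t \<in> S" for f s t
    using jacobiator_vanishes_left[of f s t] that assms S_A by blast
  have 2: "jacobiator f t g = 0" if "f \<in> A" "g \<in> A" "t \<in> S" for f t g
    using jacobiator_vanishes_left[of f t g] that 1 S_A by (metis jacobiator_cycle)
  have "jacobiator f g h = 0" if "f \<in> A" "g \<in> A" "h \<in> A" for f g h
    using jacobiator_vanishes_left[of f g h] that 2 by (metis jacobiator_cycle)
  then show ?thesis by (simp add: jacobi_on_def jacobiator_def)
qed

end

text \<open>With the second argument fixed, the difference of the two brackets is a derivation that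
  kills \<open>K\<close>. Applying this once in each slot leaves only the generators to
  compare.\<close>

lemma skew_biderivation_unique:
  assumes "skew_biderivation K S A br" "skew_biderivation K S A br'"
    and eq: "\<And>s t. s \<in> S \<Longrightarrow> t \<in> S \<Longrightarrow> br s t = br' s t"
    and "f \<in> A" "g \<in> A"
  shows "br f g = br' f g"
proof -
  interpret b: skew_biderivation K S A br by fact
  interpret b': skew_biderivation K S A br' by fact
  have left: "br f h = br' f h"
    if "f \<in> A" "h \<in> A" "\<And>s. s \<in> S \<Longrightarrow> br s h = br' s h" for f h
  proof -
    have "derivation_on A (\<lambda>f. br f h - br' f h)"
      using that(2) by (auto simp: derivation_on_def b.br_simps b'.br_simps algebra_simps)
    then have "br f h - br' f h = 0"
      using derivation_on_vanishes[of K S "\<lambda>f. br f h - br' f h" f] that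
      by (simp add: b.A_def[symmetric] b.br_simps b'.br_simps)
    then show ?thesis by simp
  qed
  have "br s g = br' s g" if "s \<in> S" for s
    using left[of g s] that assms(5) eq b.br_skew[of s g] b'.br_skew[of s g] b.S_A by auto
  then show ?thesis using left assms(4,5) by blast
qed

text \<open>The common abstraction of the polynomial algebra and of the geodesic functions. Each
  scalar is named after the generator that occurs linearly in the same formula, and absence of
  2-torsion is what turns skew-symmetry into \<open>br f f = 0\<close>.\<close>

locale cyclic_bracket = skew_biderivation K "{a, b, c}" A br
  for K A :: "'a::comm_ring_1 set" and br a b c +
  fixes wa wb wc :: 'a
  assumes two_torsion_free: "\<And>x::'a. x + x = 0 \<Longrightarrow> x = 0"
    and w_K: "wa \<in> K" "wb \<in> K" "wc \<in> K"
    and br_ab: "br a b = a * b - 2 * c - wc"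
    and br_bc: "br b c = b * c - 2 * a - wa"
    and br_ca: "br c a = a * c - 2 * b - wb"
begin

lemma gens_A [simp]: "a \<in> A" "b \<in> A" "c \<in> A"
  by (simp_all add: S_A)

lemma br_self: "f \<in> A \<Longrightarrow> br f f = 0"
  using br_skew[of f f] two_torsion_free[of "br f f"] by (simp add: eq_neg_iff_add_eq_0)

lemma br_swapped:
  "br b a = - (a * b - 2 * c - wc)"
  "br c b = - (b * c - 2 * a - wa)"
  "br a c = - (a * c - 2 * b - wb)"
  using br_skew[of b a] br_skew[of c b] br_skew[of a c] br_ab br_bc br_ca by simp_all

lemmas br_gens = br_ab br_bc br_ca br_swapped br_self

lemma jacobiator_repeated:
  assumes "f \<in> A" "h \<in> A"
  shows "jacobiator f f h = 0" "jacobiator f h f = 0" "jacobiator h f f = 0"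
proof -
  show *: "jacobiator f f h = 0"
    using assms br_skew[of h f] by (simp add: jacobiator_def br_self br_A br_uminus_right br_zero_right)
  show "jacobiator f h f = 0"
    unfolding * jacobiator_cycle[of f f h, symmetric] ..
  show "jacobiator h f f = 0"
    unfolding * jacobiator_cycle[of h f f] ..
qed

text \<open>Put \<open>u x = 2 * x^2 + x * wx\<close>. The cubic terms cancel inside each double
  bracket: \<open>br a (br b c) = u b - u c\<close>, \<open>br b (br c a) = u c - u a\<close> and
  \<open>br c (br a b) = u a - u b\<close>, and these sum to zero.\<close>

lemma jacobiator_abc:
  "jacobiator a b c = 0" "jacobiator b c a = 0" "jacobiator c a b = 0"
  "jacobiator a c b = 0" "jacobiator c b a = 0" "jacobiator b a c = 0"
proof -
  show *: "jacobiator a b c = 0"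
    using w_K by (simp add: jacobiator_def br_gens br_simps closed_A) (simp add: algebra_simps)
  show "jacobiator b c a = 0" "jacobiator c a b = 0"
    using * by (metis jacobiator_cycle)+
  show **: "jacobiator a c b = 0"
    using * jacobiator_swap[of a b c] by simp
  show "jacobiator c b a = 0" "jacobiator b a c = 0"
    using ** by (metis jacobiator_cycle)+
qed

lemma jacobi: "jacobi_on A br"
proof (rule jacobi_on_generators)
  fix r s t assume "r \<in> {a, b, c}" "s \<in> {a, b, c}" "t \<in> {a, b, c}"
  then show "jacobiator r s t = 0"
    by (elim insertE emptyE) (simp_all add: jacobiator_abc jacobiator_repeated)
qed

text \<open>A potential for the bracket: its formal partial derivatives in \<open>a\<close>,
  \<open>b\<close>, \<open>c\<close> are \<open>- br b c\<close>, \<open>- br c a\<close> and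
  \<open>- br a b\<close>.\<close>

definition casimir :: 'a where
  "casimir = a^2 + b^2 + c^2 - a * b * c + a * wa + b * wb + c * wc"

lemma casimir_A: "casimir \<in> A"
  using w_K by (simp add: casimir_def closed_A)

text \<open>By the chain rule \<open>br a casimir\<close> is \<open>br a b\<close> times the
  derivative in \<open>b\<close> plus \<open>br a c\<close> times the derivative in
  \<open>c\<close>. Since these derivatives are \<open>- br c a\<close> and \<open>- br a b\<close>,
  the two products cancel; \<open>b\<close> and \<open>c\<close> are alike, and
  \<open>br_vanishes\<close> passes to all of \<open>A\<close>.\<close>

lemma casimir_central: "poisson_central A br casimir"
proof -
  have "br s casimir = 0" if "s \<in> {a, b, c}" for s
    using that w_K
    by (elim insertE emptyE)
       (simp_all add: casimir_def power2_eq_square br_gens br_simps closed_A, simp_all add: algebra_simps)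
  then have "br f casimir = 0" if "f \<in> A" for f
    using br_vanishes that casimir_A by blast
  then show ?thesis
    using br_skew[of casimir] casimir_A by (simp add: poisson_central_def)
qed

end

section \<open>The polynomial algebra\<close>

text \<open>Single terms generate all polynomials additively, so an identity additive in
  \<open>f\<close> need only be checked on terms.\<close>

lemma poly_mapping_single_induct [case_names single add]:
  assumes "\<And>m a. Q (Poly_Mapping.single m a)"
    and "\<And>f g. Q f \<Longrightarrow> Q g \<Longrightarrow> Q (f + g)"
  shows "Q (f :: 'a \<Rightarrow>\<^sub>0 'b::monoid_add)"
proof (induction f rule: update_induct)
  case const
  \<comment> \<open>Zero is the term with coefficient 0, at an arbitrary key.\<close>
  show ?case using assms(1)[of undefined 0] by simp
next
  case (update f a b)
  \<comment> \<open>The key \<open>a\<close> is fresh, so the value overwritten is 0 and updating is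
    the same as adding a term.\<close>
  have "Poly_Mapping.update a b f = f + Poly_Mapping.single a b"
    using update(1)
    by (intro poly_mapping_eqI) (auto simp: lookup_update lookup_add lookup_single in_keys_iff when_def)
  then show ?case using assms update(3) by metis
qed

text \<open>The formal partial derivative, read off coefficientwise: the monomial \<open>m\<close>
  receives its coefficient from \<open>m\<close> with the exponent of \<open>x\<close> raised by
  one. Injectivity of this shift keeps the support finite.\<close>

lift_definition poly_pderiv ::
  "'x \<Rightarrow> (('x \<Rightarrow>\<^sub>0 nat) \<Rightarrow>\<^sub>0 'k) \<Rightarrow> (('x \<Rightarrow>\<^sub>0 nat) \<Rightarrow>\<^sub>0 'k::comm_ring_1)"
  is "\<lambda>x f m. f (m + Poly_Mapping.single x 1) * of_nat (Poly_Mapping.lookup m x + 1)"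
proof -
  fix x and f :: "('x \<Rightarrow>\<^sub>0 nat) \<Rightarrow> 'k" assume "finite {m. f m \<noteq> 0}"
  then have "finite ((\<lambda>m. m + Poly_Mapping.single x 1) -` {m. f m \<noteq> 0})"
    by (rule finite_vimageI) (simp add: inj_on_def)
  then show "finite {m. f (m + Poly_Mapping.single x 1) * of_nat (Poly_Mapping.lookup m x + 1) \<noteq> 0}"
    by (rule rev_finite_subset) auto
qed

lemma poly_pderiv_add: "poly_pderiv x (f + g) = poly_pderiv x f + poly_pderiv x g"
  by (intro poly_mapping_eqI) (simp add: poly_pderiv.rep_eq lookup_add algebra_simps)

text \<open>If the exponent of \<open>x\<close> is zero, truncated subtraction does no harm: the coefficient vanishes.\<close>

lemma poly_pderiv_single:
  "poly_pderiv x (Poly_Mapping.single m a) =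
     Poly_Mapping.single (m - Poly_Mapping.single x 1) (a * of_nat (Poly_Mapping.lookup m x))"
proof (intro poly_mapping_eqI)
  fix n
  let ?e = "Poly_Mapping.single x (1::nat)"
  show "Poly_Mapping.lookup (poly_pderiv x (Poly_Mapping.single m a)) n =
    Poly_Mapping.lookup (Poly_Mapping.single (m - ?e) (a * of_nat (Poly_Mapping.lookup m x))) n"
  proof (cases "Poly_Mapping.lookup m x = 0")
    case True
    then have "m \<noteq> n + ?e"
      by (metis add_is_0 lookup_add lookup_single_eq one_neq_zero)
    then show ?thesis using True by (simp add: poly_pderiv.rep_eq lookup_single when_def)
  next
    case False
    then have m: "m - ?e + ?e = m"
      by (intro poly_mapping_eqI) (auto simp: lookup_add lookup_minus lookup_single when_def)
    then have "m = n + ?e \<longleftrightarrow> m - ?e = n"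
      by (metis add_diff_cancel_right')
    moreover have "Poly_Mapping.lookup m x = Suc (Poly_Mapping.lookup (m - ?e) x)"
      using False by (simp add: lookup_minus)
    ultimately show ?thesis by (simp add: poly_pderiv.rep_eq lookup_single when_def)
  qed
qed

text \<open>Both sides are additive in each factor, so two single terms suffice; there the rule says
  that exponents of \<open>x\<close> add.\<close>

lemma poly_pderiv_mult: "poly_pderiv x (f * g) = f * poly_pderiv x g + poly_pderiv x f * g"
proof (induction f rule: poly_mapping_single_induct)
  case (single m a)
  show ?case
  proof (induction g rule: poly_mapping_single_induct)
    case (single n b)
    let ?e = "Poly_Mapping.single x (1::nat)"
    have shift: "k + (l - ?e) = k + l - ?e" if "Poly_Mapping.lookup l x \<noteq> 0" for k l
      using that
      by (intro poly_mapping_eqI) (auto simp: lookup_add lookup_minus lookup_single when_def)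
    \<comment> \<open>If \<open>x\<close> does not occur in \<open>l\<close>, truncated subtraction
      can make the two monomials differ, but then both coefficients are 0.\<close>
    have "Poly_Mapping.single (k + (l - ?e)) (c * of_nat (Poly_Mapping.lookup l x)) =
          Poly_Mapping.single (k + l - ?e) (c * of_nat (Poly_Mapping.lookup l x))" for k l and c :: 'b
      using shift[of l k] by (cases "Poly_Mapping.lookup l x = 0") simp_all
    from this[of m n "a * b"] this[of n m "a * b"] show ?case
      by (simp add: mult_single poly_pderiv_single lookup_add single_add[symmetric] add.commute algebra_simps)
  qed (simp add: poly_pderiv_add algebra_simps)
qed (simp add: poly_pderiv_add algebra_simps)

lemma poly_pderiv_const: "poly_pderiv x (const_poly c) = 0"
  by (simp add: const_poly_def poly_pderiv_single)

lemma poly_pderiv_indet: "poly_pderiv x (indet y) = (if x = y then 1 else 0)"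
  by (simp add: indet_def poly_pderiv_single lookup_single when_def)

lemma indet_power: "indet l ^ n = Poly_Mapping.single (Poly_Mapping.single l n) 1"
  by (induction n) (simp_all add: indet_def mult_single single_add[symmetric])

text \<open>Presents the whole polynomial type as a generated algebra, so that the results on
  derivations apply with carrier \<open>UNIV\<close>.\<close>

lemma UNIV_generated:
  "(UNIV :: 'k::comm_ring_1 poly3 set) =
     generated_algebra (range const_poly) {indet L12, indet L23, indet L13}"
proof -
  let ?A = "generated_algebra (range const_poly) {indet L12, indet L23, indet L13} :: 'k poly3 set"
  have one: "1 \<in> range (const_poly :: 'k \<Rightarrow> 'k poly3)"
    by (metis const_poly_def range_eqI single_one)
  have "f \<in> ?A" for f
  proof (induction f rule: poly_mapping_single_induct)
    case (single m a)
    define e where "e = Poly_Mapping.lookup m"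
    have m: "m = Poly_Mapping.single L12 (e L12) + Poly_Mapping.single L23 (e L23)
        + Poly_Mapping.single L13 (e L13)"
    proof (intro poly_mapping_eqI)
      show "Poly_Mapping.lookup m l = Poly_Mapping.lookup (Poly_Mapping.single L12 (e L12)
        + Poly_Mapping.single L23 (e L23) + Poly_Mapping.single L13 (e L13)) l" for l
        by (cases l) (simp_all add: lookup_add lookup_single e_def)
    qed
    have "Poly_Mapping.single m a =
        const_poly a * (indet L12 ^ e L12 * indet L23 ^ e L23 * indet L13 ^ e L13)"
      by (subst m) (simp add: indet_power const_poly_def mult_single)
    moreover have "indet l ^ n \<in> ?A" for l n
      by (rule generated_algebra_power[OF one]) (cases l; simp add: generated_algebra.gen)
    ultimately show ?case by (simp add: generated_algebra.coeff generated_algebra.mult)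
  qed (rule generated_algebra.add)
  then show ?thesis by auto
qed

text \<open>The existence witness: \<open>J x y\<close> is the Jacobian minor of \<open>f\<close>
  and \<open>g\<close>, and each minor is weighted by the bracket prescribed for its pair of
  indeterminates.\<close>

definition poly3_bracket :: "'k \<Rightarrow> 'k \<Rightarrow> 'k \<Rightarrow> 'k poly3 \<Rightarrow> 'k poly3 \<Rightarrow> 'k::comm_ring_1 poly3" where
  "poly3_bracket \<omega>12 \<omega>23 \<omega>13 f g =
     (let D = poly_pderiv;
          g12 = indet L12; g23 = indet L23; g13 = indet L13;
          J = (\<lambda>x y. D x f * D y g - D y f * D x g)
      in J L12 L23 * (g12 * g23 - 2 * g13 - const_poly \<omega>13)
       + J L23 L13 * (g23 * g13 - 2 * g12 - const_poly \<omega>12)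
       + J L13 L12 * (g12 * g13 - 2 * g23 - const_poly \<omega>23))"

text \<open>Names the predicate \<open>defined_by_formulae\<close> of the final theorem, whose proof
  folds it back to this constant.\<close>

definition poly3_formulae ::
    "'k \<Rightarrow> 'k \<Rightarrow> 'k \<Rightarrow> ('k poly3 \<Rightarrow> 'k poly3 \<Rightarrow> 'k::comm_ring_1 poly3) \<Rightarrow> bool" where
  "poly3_formulae \<omega>12 \<omega>23 \<omega>13 br \<longleftrightarrow>
     skew_biderivation_on (range const_poly) UNIV br \<and>
     br (indet L12) (indet L23) = indet L12 * indet L23 - 2 * indet L13 - const_poly \<omega>13 \<and>
     br (indet L23) (indet L13) = indet L23 * indet L13 - 2 * indet L12 - const_poly \<omega>12 \<and>
     br (indet L13) (indet L12) = indet L12 * indet L13 - 2 * indet L23 - const_poly \<omega>23"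

lemma poly3_formulae_bracket:
  "poly3_formulae \<omega>12 \<omega>23 \<omega>13 (poly3_bracket \<omega>12 \<omega>23 \<omega>13)"
proof -
  have "skew_biderivation_on (range const_poly) UNIV (poly3_bracket \<omega>12 \<omega>23 \<omega>13)"
    unfolding skew_biderivation_on_def
    by (auto simp: poly3_bracket_def Let_def poly_pderiv_add poly_pderiv_mult poly_pderiv_const
        algebra_simps)
  then show ?thesis
    by (simp add: poly3_formulae_def) (simp add: poly3_bracket_def poly_pderiv_indet)
qed

lemma cyclic_bracket_poly3:
  fixes br :: "'k::field_char_0 poly3 \<Rightarrow> 'k poly3 \<Rightarrow> 'k poly3"
  assumes "poly3_formulae \<omega>12 \<omega>23 \<omega>13 br"
  shows "cyclic_bracket (range const_poly) UNIV br (indet L12) (indet L23) (indet L13)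
           (const_poly \<omega>12) (const_poly \<omega>23) (const_poly \<omega>13)"
proof
  show "1 \<in> range (const_poly :: 'k \<Rightarrow> 'k poly3)"
    by (metis const_poly_def range_eqI single_one)
  show "- 1 \<in> range (const_poly :: 'k \<Rightarrow> 'k poly3)"
    by (metis const_poly_def range_eqI single_one single_uminus)
  \<comment> \<open>Checked coefficient by coefficient, where characteristic 0 allows division by
    2.\<close>
  show "x = 0" if "x + x = 0" for x :: "'k poly3"
  proof (intro poly_mapping_eqI)
    fix k
    have "Poly_Mapping.lookup x k + Poly_Mapping.lookup x k = 0"
      unfolding lookup_add[symmetric] that by simp
    then show "Poly_Mapping.lookup x k = Poly_Mapping.lookup 0 k" by simp
  qed
qed (use assms in \<open>simp_all add: UNIV_generated poly3_formulae_def\<close>)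

text \<open>All nine brackets of generators are forced: three by the formulae, three by
  skew-symmetry, and the diagonal ones are 0.\<close>

lemma cyclic_bracket_unique:
  assumes "cyclic_bracket K UNIV br a b c wa wb wc" "cyclic_bracket K UNIV br' a b c wa wb wc"
  shows "br = br'"
proof -
  interpret b: cyclic_bracket K UNIV br a b c wa wb wc by fact
  interpret b': cyclic_bracket K UNIV br' a b c wa wb wc by fact
  have "br s t = br' s t" if "s \<in> {a, b, c}" "t \<in> {a, b, c}" for s t
    using that by (elim insertE emptyE) (simp_all add: b.br_gens b'.br_gens)
  then show ?thesis
    using skew_biderivation_unique[OF b.skew_biderivation_axioms b'.skew_biderivation_axioms]
    by (intro ext) blast
qed

lemma poly3_formulae_ex1:
  "\<exists>!br :: 'k::field_char_0 poly3 \<Rightarrow> 'k poly3 \<Rightarrow> 'k poly3. poly3_formulae \<omega>12 \<omega>23 \<omega>13 br"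
  using poly3_formulae_bracket cyclic_bracket_unique[OF cyclic_bracket_poly3 cyclic_bracket_poly3]
  by (intro ex_ex1I) blast+

lemma poly3_formulae_poisson:
  fixes br :: "'k::field_char_0 poly3 \<Rightarrow> 'k poly3 \<Rightarrow> 'k poly3"
  assumes "poly3_formulae \<omega>12 \<omega>23 \<omega>13 br"
  shows "poisson_algebra_on (range const_poly) UNIV br"
    and "poisson_central UNIV br ((indet L12)\<^sup>2 + (indet L23)\<^sup>2 + (indet L13)\<^sup>2
      - indet L12 * indet L23 * indet L13 + indet L12 * const_poly \<omega>12
      + indet L23 * const_poly \<omega>23 + indet L13 * const_poly \<omega>13)"
proof -
  interpret cyclic_bracket "range const_poly" UNIV br "indet L12" "indet L23" "indet L13"
    "const_poly \<omega>12" "const_poly \<omega>23" "const_poly \<omega>13"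
    by (rule cyclic_bracket_poly3[OF assms])
  show "poisson_algebra_on (range const_poly) UNIV br"
    using biderivation jacobi by (simp add: poisson_algebra_on_def)
  show "poisson_central UNIV br ((indet L12)\<^sup>2 + (indet L23)\<^sup>2 + (indet L13)\<^sup>2
      - indet L12 * indet L23 * indet L13 + indet L12 * const_poly \<omega>12
      + indet L23 * const_poly \<omega>23 + indet L13 * const_poly \<omega>13)"
    using casimir_central by (simp add: casimir_def)
qed

section \<open>Traces of words in three matrices\<close>

lemma matrix_2_eqI:
  fixes A B :: "'a^2^2"
  assumes "A$1$1 = B$1$1" "A$1$2 = B$1$2" "A$2$1 = B$2$1" "A$2$2 = B$2$2"
  shows "A = B"
  using assms by (simp add: vec_eq_iff forall_2)

lemma trace_2: "trace (A :: 'a::semiring_1^2^2) = A$1$1 + A$2$2"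
  by (simp add: trace_def sum_2)

lemma trace_scaleR: "trace (c *\<^sub>R A) = c * trace (A :: real^'n^'n)"
  by (simp add: trace_def sum_distrib_left)

lemma matrix_add_rdistrib:
  fixes A B :: "'a::semiring_1^'n^'m"
  shows "(A + B) ** C = A ** C + B ** C"
  by (simp add: matrix_matrix_mult_def vec_eq_iff distrib_right sum.distrib)

lemma mat_2_nth [simp]:
  "(mat 1 :: real^2^2)$1$1 = 1" "(mat 1 :: real^2^2)$1$2 = 0"
  "(mat 1 :: real^2^2)$2$1 = 0" "(mat 1 :: real^2^2)$2$2 = 1"
  by (simp_all add: mat_def)

text \<open>The polarised Cayley-Hamilton identity; the polarisation of the determinant is
  \<open>trace A * trace B - trace (A ** B)\<close>, so only traces occur as coefficients.\<close>

lemma Cayley_Hamilton_2: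
  fixes A B :: "real^2^2"
  shows "B ** A = (- 1) *\<^sub>R (A ** B) + trace A *\<^sub>R B + trace B *\<^sub>R A
           + (trace (A ** B) - trace A * trace B) *\<^sub>R mat 1"
  by (rule matrix_2_eqI) (simp_all add: matrix_matrix_mult_def sum_2 trace_2 algebra_simps)

lemma Cayley_Hamilton_2_square:
  fixes A :: "real^2^2"
  shows "A ** A = trace A *\<^sub>R A + (- det A) *\<^sub>R mat 1"
  by (rule matrix_2_eqI) (simp_all add: matrix_matrix_mult_def sum_2 trace_2 det_2 algebra_simps)

text \<open>Cayley-Hamilton in the form \<open>A ** (trace A - A) = det A\<close>. It makes inverses
  linear combinations of the matrix and the identity with trace coefficients.\<close>

lemma matrix_inv_2:
  fixes A :: "real^2^2"
  assumes "det A = 1"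
  shows "matrix_inv A = trace A *\<^sub>R mat 1 + (- 1) *\<^sub>R A"
proof -
  let ?B = "trace A *\<^sub>R mat 1 + (- 1) *\<^sub>R A"
  have "A ** ?B = det A *\<^sub>R mat 1" "?B ** A = det A *\<^sub>R mat 1"
    by (rule matrix_2_eqI;
        simp add: matrix_matrix_mult_def sum_2 trace_2 det_2; simp add: algebra_simps)+
  then have *: "A ** ?B = mat 1" "?B ** A = mat 1"
    unfolding assms by simp_all
  \<comment> \<open>\<open>matrix_inv\<close> is defined by choice; the witness \<open>?B\<close>
    shows that a two-sided inverse exists, hence the chosen matrix is one.\<close>
  then have inv: "A ** matrix_inv A = mat 1"
    unfolding matrix_inv_def by (rule_tac someI2[where a = ?B]) auto
  have "matrix_inv A = ?B ** A ** matrix_inv A"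
    unfolding * by simp
  also have "\<dots> = ?B"
    unfolding matrix_mul_assoc[symmetric] inv by simp
  finally show ?thesis .
qed

lemma det_matrix_inv_2:
  fixes A :: "real^2^2"
  assumes "det A = 1"
  shows "det (matrix_inv A) = 1"
proof -
  have "det (trace A *\<^sub>R mat 1 + (- 1) *\<^sub>R A) = det A"
    by (simp add: det_2 trace_2)
  then show ?thesis using assms by (simp only: matrix_inv_2[OF assms])
qed

section \<open>Matrix-valued functions and modules over a ring of functions\<close>

type_synonym 'z matfun = "'z \<Rightarrow> real^2^2"

definition matfun_mult :: "'z matfun \<Rightarrow> 'z matfun \<Rightarrow> 'z matfun" (infixl \<open>\<otimes>\<close> 70) where
  "X \<otimes> Y = (\<lambda>z. X z ** Y z)"

definition matfun_scale :: "('z \<Rightarrow> real) \<Rightarrow> 'z matfun \<Rightarrow> 'z matfun" (infixr \<open>\<odot>\<close> 75) where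
  "f \<odot> X = (\<lambda>z. f z *\<^sub>R X z)"

definition matfun_one :: "'z matfun" where
  "matfun_one = (\<lambda>z. mat 1)"

definition matfun_trace :: "'z matfun \<Rightarrow> 'z \<Rightarrow> real" where
  "matfun_trace X = (\<lambda>z. trace (X z))"

lemma matfun_mult_add_left: "(X + Y) \<otimes> Z = X \<otimes> Z + Y \<otimes> Z"
  and matfun_mult_add_right: "Z \<otimes> (X + Y) = Z \<otimes> X + Z \<otimes> Y"
  and matfun_mult_scale_left: "(f \<odot> X) \<otimes> Y = f \<odot> (X \<otimes> Y)"
  and matfun_mult_scale_right: "X \<otimes> (f \<odot> Y) = f \<odot> (X \<otimes> Y)"
  and matfun_scale_add: "f \<odot> (X + Y) = f \<odot> X + f \<odot> Y"
  and matfun_mult_assoc: "X \<otimes> Y \<otimes> Z = X \<otimes> (Y \<otimes> Z)"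
  and matfun_mult_one: "X \<otimes> matfun_one = X" "matfun_one \<otimes> X = X"
  and matfun_trace_add: "matfun_trace (X + Y) = matfun_trace X + matfun_trace Y"
  and matfun_trace_scale: "matfun_trace (f \<odot> X) = f * matfun_trace X"
  by (auto simp: matfun_mult_def matfun_scale_def matfun_one_def matfun_trace_def fun_eq_iff
      matrix_add_ldistrib matrix_add_rdistrib scalar_matrix_assoc matrix_scalar_ac
      matrix_mul_assoc scaleR_add_right trace_add trace_scaleR)

lemmas matfun_simps = matfun_mult_add_left matfun_mult_add_right matfun_mult_scale_left
  matfun_mult_scale_right matfun_scale_add matfun_mult_one

definition matfun_module :: "('z \<Rightarrow> real) set \<Rightarrow> 'z matfun set \<Rightarrow> bool" where
  "matfun_module T M \<longleftrightarrow>
     (\<forall>X\<in>M. \<forall>Y\<in>M. X + Y \<in> M) \<and> (\<forall>f\<in>T. \<forall>X\<in>M. f \<odot> X \<in> M)"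

text \<open>Adjoins \<open>H\<close> as a new rightmost factor of degree at most one. Three such
  steps, starting from the scalars, yield all ordered products of three matrices.\<close>

definition matfun_extend :: "'z matfun set \<Rightarrow> 'z matfun \<Rightarrow> 'z matfun set" where
  "matfun_extend M H = {X + Y \<otimes> H | X Y. X \<in> M \<and> Y \<in> M}"

definition right_stable :: "'z matfun set \<Rightarrow> 'z matfun \<Rightarrow> bool" where
  "right_stable M H \<longleftrightarrow> (\<forall>X\<in>M. X \<otimes> H \<in> M)"

lemma matfun_module_extend:
  assumes "matfun_module T M"
  shows "matfun_module T (matfun_extend M H)"
proof -
  have "X + Y \<otimes> H + (X' + Y' \<otimes> H) = (X + X') + (Y + Y') \<otimes> H" for X X' Y Y'
    by (simp add: matfun_simps add_ac)
  moreover have "f \<odot> (X + Y \<otimes> H) = f \<odot> X + (f \<odot> Y) \<otimes> H" for f X Y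
    by (simp add: matfun_simps)
  ultimately show ?thesis
    using assms unfolding matfun_module_def matfun_extend_def by blast
qed

text \<open>The quadratic relation lowers \<open>H\<close> squared back to degree one in
  \<open>H\<close>.\<close>

lemma right_stable_extend_self:
  assumes M: "matfun_module T M" and sq: "H \<otimes> H = t \<odot> H + s \<odot> matfun_one"
    and T: "t \<in> T" "s \<in> T"
  shows "right_stable (matfun_extend M H) H"
proof -
  have "(X + Y \<otimes> H) \<otimes> H = s \<odot> Y + (X + t \<odot> Y) \<otimes> H" for X Y
    by (simp add: matfun_simps matfun_mult_assoc sq add_ac)
  then show ?thesis
    using M T unfolding right_stable_def matfun_module_def matfun_extend_def by blast
qed

text \<open>The relation moves \<open>F\<close> to the left past \<open>H\<close>, where
  \<open>M\<close> absorbs it; the correction terms contain \<open>H\<close> or \<open>F\<close>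
  only once.\<close>

lemma right_stable_extend:
  assumes M: "matfun_module T M" and stable: "right_stable M F"
    and comm: "H \<otimes> F = r \<odot> (F \<otimes> H) + s \<odot> H + t \<odot> F + u \<odot> matfun_one"
    and T: "r \<in> T" "s \<in> T" "t \<in> T" "u \<in> T"
  shows "right_stable (matfun_extend M H) F"
proof -
  have "(X + Y \<otimes> H) \<otimes> F
      = (X \<otimes> F + t \<odot> (Y \<otimes> F) + u \<odot> Y) + (r \<odot> (Y \<otimes> F) + s \<odot> Y) \<otimes> H" for X Y
    by (simp add: matfun_simps matfun_mult_assoc comm add_ac)
  then show ?thesis
    using M T stable unfolding right_stable_def matfun_module_def matfun_extend_def by blast
qed

lemma right_stable_add:
  "matfun_module T M \<Longrightarrow> right_stable M X \<Longrightarrow> right_stable M Y \<Longrightarrow> right_stable M (X + Y)"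
  by (simp add: right_stable_def matfun_module_def matfun_simps)

lemma right_stable_mult: "right_stable M X \<Longrightarrow> right_stable M Y \<Longrightarrow> right_stable M (X \<otimes> Y)"
  by (simp add: right_stable_def matfun_mult_assoc[symmetric])

definition matfun_scalars :: "('z \<Rightarrow> real) set \<Rightarrow> 'z matfun set" where
  "matfun_scalars T = {f \<odot> matfun_one | f. f \<in> T}"

lemma right_stable_scalars:
  "matfun_module T M \<Longrightarrow> X \<in> matfun_scalars T \<Longrightarrow> right_stable M X"
  by (auto simp: right_stable_def matfun_module_def matfun_scalars_def matfun_simps)

text \<open>The functions whose right multiplication preserves \<open>N\<close> are closed under
  sums and products, so stability under \<open>M\<close> and \<open>H\<close> gives stability under
  the whole extension.\<close>

lemma right_stable_of_extend:
  assumes "matfun_module T N" "right_stable N H" "\<And>X. X \<in> M \<Longrightarrow> right_stable N X"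
    and "X \<in> matfun_extend M H"
  shows "right_stable N X"
proof -
  obtain Y Z where "X = Y + Z \<otimes> H" "Y \<in> M" "Z \<in> M"
    using assms(4) unfolding matfun_extend_def by blast
  then show ?thesis
    using right_stable_add[OF assms(1) assms(3) right_stable_mult[OF assms(3) assms(2)]] by simp
qed

lemma matfun_extend_subset:
  assumes "matfun_module T M" "0 \<in> T"
  shows "M \<subseteq> matfun_extend M H"
proof
  fix X assume X: "X \<in> M"
  \<comment> \<open>Scaling by 0 supplies the zero element needed as coefficient of
    \<open>H\<close>.\<close>
  then have "0 \<odot> X \<in> M" using assms by (simp add: matfun_module_def)
  moreover have "X = X + (0 \<odot> X) \<otimes> H"
    by (simp add: matfun_scale_def matfun_mult_def fun_eq_iff)
  ultimately show "X \<in> matfun_extend M H"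
    using X unfolding matfun_extend_def by blast
qed

text \<open>
  The module spanned over \<open>T\<close> by the eight ordered products of \<open>A\<close>, \<open>B\<close>, \<open>C\<close> is an algebra,
  since Cayley-Hamilton reorders any product.
\<close>

locale three_matrices =
  fixes T :: "('z \<Rightarrow> real) set" and A B C :: "'z matfun"
  assumes T_const: "(\<lambda>z. c) \<in> T"
    and T_add: "f \<in> T \<Longrightarrow> g \<in> T \<Longrightarrow> f + g \<in> T"
    and T_mult: "f \<in> T \<Longrightarrow> g \<in> T \<Longrightarrow> f * g \<in> T"
    and det_gens: "det (A z) = 1" "det (B z) = 1" "det (C z) = 1"
    and trace_gens: "matfun_trace A \<in> T" "matfun_trace B \<in> T" "matfun_trace C \<in> T"
    and trace_pairs: "matfun_trace (A \<otimes> B) \<in> T" "matfun_trace (A \<otimes> C) \<in> T" "matfun_trace (B \<otimes> C) \<in> T"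
    and trace_triple: "matfun_trace (A \<otimes> B \<otimes> C) \<in> T"
begin

lemma T_zero: "0 \<in> T" and T_one: "1 \<in> T" and T_minus_one: "- 1 \<in> T"
  using T_const[of 0] T_const[of 1] T_const[of "- 1"]
  by (simp_all add: zero_fun_def one_fun_def fun_Compl_def)

lemma T_diff: "f \<in> T \<Longrightarrow> g \<in> T \<Longrightarrow> f - g \<in> T"
  using T_add[of f "- 1 * g"] T_mult[OF T_minus_one, of g] by simp

abbreviation "M0 \<equiv> matfun_scalars T"
abbreviation "M1 \<equiv> matfun_extend M0 A"
abbreviation "M2 \<equiv> matfun_extend M1 B"
abbreviation "M3 \<equiv> matfun_extend M2 C"

lemma module_M0: "matfun_module T M0"
proof -
  have "f \<odot> matfun_one + g \<odot> matfun_one = (f + g) \<odot> matfun_one" for f g :: "'z \<Rightarrow> real"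
    by (simp add: matfun_scale_def fun_eq_iff scaleR_add_left)
  moreover have "f \<odot> g \<odot> matfun_one = (f * g) \<odot> matfun_one" for f g :: "'z \<Rightarrow> real"
    by (simp add: matfun_scale_def fun_eq_iff)
  ultimately show ?thesis
    unfolding matfun_module_def matfun_scalars_def using T_add T_mult by blast
qed

lemmas module_M = module_M0 matfun_module_extend[OF module_M0]
  matfun_module_extend[OF matfun_module_extend[OF module_M0]]
  matfun_module_extend[OF matfun_module_extend[OF matfun_module_extend[OF module_M0]]]

lemma stable_self:
  assumes "matfun_module T M" "\<And>z. det (H z) = 1" "matfun_trace H \<in> T"
  shows "right_stable (matfun_extend M H) H"
proof (rule right_stable_extend_self[OF assms(1) _ assms(3) T_minus_one])
  show "H \<otimes> H = matfun_trace H \<odot> H + - 1 \<odot> matfun_one"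
    using assms(2)
    by (simp add: Cayley_Hamilton_2_square fun_eq_iff matfun_mult_def matfun_scale_def matfun_trace_def matfun_one_def)
qed

lemma stable_other:
  assumes "matfun_module T M" "right_stable M F"
    "matfun_trace F \<in> T" "matfun_trace H \<in> T" "matfun_trace (F \<otimes> H) \<in> T"
  shows "right_stable (matfun_extend M H) F"
proof (rule right_stable_extend[OF assms(1,2) _ T_minus_one assms(3,4)])
  show "H \<otimes> F = - 1 \<odot> (F \<otimes> H) + matfun_trace F \<odot> H + matfun_trace H \<odot> F
      + (matfun_trace (F \<otimes> H) - matfun_trace F * matfun_trace H) \<odot> matfun_one"
  proof
    show "(H \<otimes> F) z = (- 1 \<odot> (F \<otimes> H) + matfun_trace F \<odot> H + matfun_trace H \<odot> F
      + (matfun_trace (F \<otimes> H) - matfun_trace F * matfun_trace H) \<odot> matfun_one) z" for z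
      using Cayley_Hamilton_2[of "H z" "F z"]
      by (simp add: matfun_mult_def matfun_scale_def matfun_trace_def matfun_one_def)
  qed
  show "matfun_trace (F \<otimes> H) - matfun_trace F * matfun_trace H \<in> T"
    using assms by (simp add: T_diff T_mult)
qed

text \<open>Each generator is absorbed by its own quadratic relation at the stage where it is
  adjoined, and survives later stages by commuting past the newer factors.\<close>

lemma stable_gens: "right_stable M3 A" "right_stable M3 B" "right_stable M3 C"
  by (intro stable_self stable_other module_M trace_gens trace_pairs det_gens)+

lemma one_M3: "matfun_one \<in> M3"
proof -
  have "1 \<odot> matfun_one = (matfun_one :: 'z matfun)"
    by (simp add: matfun_scale_def fun_eq_iff)
  then have "matfun_one \<in> M0"
    unfolding matfun_scalars_def using T_one by (metis (mono_tags, lifting) mem_Collect_eq)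
  then show ?thesis
    using matfun_extend_subset module_M T_zero by blast
qed

lemma stable_M3:
  assumes "X \<in> M3"
  shows "right_stable M3 X"
  by (rule right_stable_of_extend[OF module_M(4) stable_gens(3)
        right_stable_of_extend[OF module_M(4) stable_gens(2)
          right_stable_of_extend[OF module_M(4) stable_gens(1)
            right_stable_scalars[OF module_M(4)]]] assms])

lemma mult_M3: "X \<in> M3 \<Longrightarrow> Y \<in> M3 \<Longrightarrow> X \<otimes> Y \<in> M3"
  using stable_M3 by (simp add: right_stable_def)

lemma gens_M3: "A \<in> M3" "B \<in> M3" "C \<in> M3"
  using stable_gens one_M3 by (metis matfun_mult_one(2) right_stable_def)+

text \<open>The trace is linear over \<open>T\<close>, and the traces of the eight ordered products
  are the constant 2 and the seven functions assumed to lie in \<open>T\<close>.\<close>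

lemma trace_M3:
  assumes "X \<in> M3"
  shows "matfun_trace X \<in> T"
proof -
  have M1: "\<exists>f g. f \<in> T \<and> g \<in> T \<and> Y = f \<odot> matfun_one + g \<odot> A" if Y: "Y \<in> M1" for Y
  proof -
    from Y obtain P Q where Y: "Y = P + Q \<otimes> A" and PQ: "P \<in> M0" "Q \<in> M0"
      unfolding matfun_extend_def by blast
    from PQ obtain f g where "f \<in> T" "g \<in> T" "P = f \<odot> matfun_one" "Q = g \<odot> matfun_one"
      unfolding matfun_scalars_def by blast
    then show ?thesis using Y by (auto simp: matfun_simps)
  qed
  obtain P Q where X: "X = P + Q \<otimes> C" and PQ: "P \<in> M2" "Q \<in> M2"
    using assms unfolding matfun_extend_def[of M2] by blast
  obtain P1 P2 where P: "P = P1 + P2 \<otimes> B" and P12: "P1 \<in> M1" "P2 \<in> M1"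
    using PQ(1) unfolding matfun_extend_def[of M1] by blast
  obtain Q1 Q2 where Q: "Q = Q1 + Q2 \<otimes> B" and Q12: "Q1 \<in> M1" "Q2 \<in> M1"
    using PQ(2) unfolding matfun_extend_def[of M1] by blast
  obtain f1 f2 where 1: "f1 \<in> T" "f2 \<in> T" "P1 = f1 \<odot> matfun_one + f2 \<odot> A"
    using M1[OF P12(1)] by blast
  obtain f3 f4 where 2: "f3 \<in> T" "f4 \<in> T" "P2 = f3 \<odot> matfun_one + f4 \<odot> A"
    using M1[OF P12(2)] by blast
  obtain f5 f6 where 3: "f5 \<in> T" "f6 \<in> T" "Q1 = f5 \<odot> matfun_one + f6 \<odot> A"
    using M1[OF Q12(1)] by blast
  obtain f7 f8 where 4: "f7 \<in> T" "f8 \<in> T" "Q2 = f7 \<odot> matfun_one + f8 \<odot> A"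
    using M1[OF Q12(2)] by blast
  have "matfun_trace matfun_one = (\<lambda>z::'z. 2)"
    by (simp add: matfun_trace_def matfun_one_def trace_I)
  then have "matfun_trace (matfun_one :: 'z matfun) \<in> T"
    using T_const by simp
  then show ?thesis
    unfolding X P Q 1(3) 2(3) 3(3) 4(3)
    using 1(1,2) 2(1,2) 3(1,2) 4(1,2) trace_gens trace_pairs trace_triple
    by (simp add: matfun_simps matfun_trace_add matfun_trace_scale T_add T_mult)
qed

end

section \<open>Geodesic functions in shear coordinates\<close>

definition spoke :: "3 \<Rightarrow> shear \<Rightarrow> real" where
  "spoke i z = exp (z $ Yedge i + z $ Pedge i / 2)"

definition perimeter :: "3 \<Rightarrow> shear \<Rightarrow> real" where
  "perimeter i z = exp (z $ Pedge i / 2) + exp (- (z $ Pedge i / 2))"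

lemma spoke_nz [simp]: "spoke i z \<noteq> 0"
  by (simp add: spoke_def)

lemma petal_eq:
  "petal i z = vector [vector [0, - spoke i z], vector [1 / spoke i z, - perimeter i z]]"
proof -
  \<comment> \<open>With the half-exponentials as atoms every entry is rational, and the spoke
    becomes \<open>y * y * q\<close>.\<close>
  define y q where "y = exp (z $ Yedge i / 2)" and "q = exp (z $ Pedge i / 2)"
  have nz: "y \<noteq> 0" "q \<noteq> 0" by (simp_all add: y_def q_def)
  have X: "matX (z $ Yedge i) = vector [vector [0, - y], vector [1 / y, 0]]"
    "matX (z $ Pedge i) = vector [vector [0, - q], vector [1 / q, 0]]"
    by (simp_all add: matX_def y_def q_def exp_minus inverse_eq_divide)
  have "exp (z $ Yedge i) = y * y"
    by (simp add: y_def exp_add[symmetric])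
  then have spoke: "spoke i z = y * y * q"
    by (simp add: spoke_def exp_add q_def)
  have p: "perimeter i z = q + 1 / q"
    by (simp add: perimeter_def q_def exp_minus inverse_eq_divide)
  show ?thesis
    unfolding petal_def X spoke p matR_def using nz
    by (intro matrix_2_eqI) (simp_all add: matrix_matrix_mult_def sum_2 field_simps)
qed

lemma gamma_eqs:
  "gamma 1 z = vector [vector [0, - spoke 1 z], vector [1 / spoke 1 z, - perimeter 1 z]]"
  "gamma 2 z = vector [vector [- spoke 2 z - perimeter 2 z, - 1 / spoke 2 z - spoke 2 z - perimeter 2 z],
                       vector [spoke 2 z, spoke 2 z]]"
  "gamma 3 z = vector [vector [- 1 / spoke 3 z - perimeter 3 z, - 1 / spoke 3 z],
                       vector [1 / spoke 3 z + spoke 3 z + perimeter 3 z, 1 / spoke 3 z]]"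
  by (intro matrix_2_eqI;
      simp add: gamma_def petal_eq matR_def matL_def matrix_matrix_mult_def sum_2)+

lemma det_gamma: "det (gamma i z) = 1"
proof -
  have "det (gamma 1 z) = 1" "det (gamma 2 z) = 1" "det (gamma 3 z) = 1"
    by (simp_all add: gamma_eqs det_2 field_simps)
  then show ?thesis using exhaust_3[of i] by metis
qed

lemma G_eq: "G i = perimeter i"
proof -
  have "G 1 z = perimeter 1 z" "G 2 z = perimeter 2 z" "G 3 z = perimeter 3 z" for z
    by (simp_all add: G_def trace_2 gamma_eqs)
  then show ?thesis using exhaust_3[of i] by (metis ext)
qed

text \<open>Only the product of the three spokes enters, so the derivatives along the three
  \<open>Y\<close> coordinates agree; this is the source of centrality.\<close>

lemma G_inf_eq: "G_inf = (\<lambda>z. spoke 1 z * spoke 2 z * spoke 3 z + 1 / (spoke 1 z * spoke 2 z * spoke 3 z))"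
  by (rule ext) (simp add: G_inf_def trace_2 gamma_eqs matrix_matrix_mult_def sum_2 field_simps)

text \<open>The formula is not symmetric in \<open>i\<close> and \<open>j\<close> but follows the
  cyclic order of the spokes, which is why the pair 1, 3 appears below as
  \<open>pair_function 3 1\<close>.\<close>

definition pair_function :: "3 \<Rightarrow> 3 \<Rightarrow> shear \<Rightarrow> real" where
  "pair_function i j z = spoke i z * spoke j z + 1 / (spoke i z * spoke j z) + spoke j z / spoke i z
     + perimeter j z / spoke i z + perimeter i z * spoke j z"

lemma G_pair_eqs:
  "G_pair 1 2 = pair_function 1 2"
  "G_pair 2 3 = pair_function 2 3"
  "G_pair 1 3 = pair_function 3 1"
  by (rule ext, simp add: G_pair_def pair_function_def trace_2 gamma_eqs matrix_matrix_mult_def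
        sum_2 field_simps)+

text \<open>A relation rather than a value, so that it records differentiability, which the total
  function \<open>deriv\<close> does not.\<close>

definition has_Ypartial :: "3 \<Rightarrow> (shear \<Rightarrow> real) \<Rightarrow> real \<Rightarrow> shear \<Rightarrow> bool" where
  "has_Ypartial j f D z \<longleftrightarrow>
     ((\<lambda>t. f (z + t *\<^sub>R axis (Yedge j) 1)) has_real_derivative D) (at 0)"

lemma partial_eqI: "has_Ypartial j f D z \<Longrightarrow> partial (Yedge j) f z = D"
  unfolding partial_def has_Ypartial_def by (rule DERIV_imp_deriv)

text \<open>The derivative enters this rule and the following ones through an equation, so any
  expected form of it can be matched and the comparison is left as an algebraic identity.\<close>

lemma has_Ypartial_const: "D = 0 \<Longrightarrow> has_Ypartial j (\<lambda>z. c) D z"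
  by (simp add: has_Ypartial_def)

lemma has_Ypartial_add:
  "has_Ypartial j f D z \<Longrightarrow> has_Ypartial j g E z \<Longrightarrow> F = D + E \<Longrightarrow>
     has_Ypartial j (\<lambda>z. f z + g z) F z"
  by (simp add: has_Ypartial_def DERIV_add)

lemma has_Ypartial_mult:
  assumes "has_Ypartial j f D z" "has_Ypartial j g E z" "F = f z * E + D * g z"
  shows "has_Ypartial j (\<lambda>z. f z * g z) F z"
  using DERIV_mult[OF assms(1,2)[unfolded has_Ypartial_def]] assms(3)
  by (simp add: has_Ypartial_def algebra_simps)

lemma has_Ypartial_divide:
  assumes "has_Ypartial j f D z" "has_Ypartial j g E z" "g z \<noteq> 0"
    and "F = (D * g z - f z * E) / (g z * g z)"
  shows "has_Ypartial j (\<lambda>z. f z / g z) F z"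
  using DERIV_divide[OF assms(1,2)[unfolded has_Ypartial_def]] assms(3,4)
  by (simp add: has_Ypartial_def)

lemma has_Ypartial_spoke: "D = (if i = j then spoke i z else 0) \<Longrightarrow> has_Ypartial j (spoke i) D z"
proof -
  assume D: "D = (if i = j then spoke i z else 0)"
  have "spoke i (z + t *\<^sub>R axis (Yedge j) 1) = spoke i z * exp (if i = j then t else 0)" for t
    by (simp add: spoke_def axis_def exp_add)
  then show ?thesis
    by (auto simp: has_Ypartial_def D intro!: derivative_eq_intros)
qed

lemma has_Ypartial_perimeter: "D = 0 \<Longrightarrow> has_Ypartial j (perimeter i) D z"
  by (simp add: has_Ypartial_def perimeter_def axis_def)

lemmas has_Ypartial_intros = has_Ypartial_const has_Ypartial_add has_Ypartial_mult
  has_Ypartial_divide has_Ypartial_spoke has_Ypartial_perimeter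

lemma has_Ypartial_G_inf:
  "has_Ypartial j G_inf (spoke 1 z * spoke 2 z * spoke 3 z - 1 / (spoke 1 z * spoke 2 z * spoke 3 z)) z"
  unfolding G_inf_eq
  by (rule has_Ypartial_intros refl | simp; fail)+
    (use exhaust_3[of j] in \<open>auto simp: field_simps\<close>)

lemma has_Ypartial_pair_function:
  assumes "i \<noteq> j"
  shows "has_Ypartial k (pair_function i j)
    (if k = i then spoke i z * spoke j z - 1 / (spoke i z * spoke j z) - spoke j z / spoke i z - perimeter j z / spoke i z
     else if k = j then spoke i z * spoke j z - 1 / (spoke i z * spoke j z) + spoke j z / spoke i z + perimeter i z * spoke j z
     else 0) z"
  unfolding pair_function_def[abs_def]
  by (rule has_Ypartial_intros refl | simp; fail)+
    (use assms in \<open>auto simp: field_simps\<close>)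

definition Y_differentiable :: "(shear \<Rightarrow> real) \<Rightarrow> bool" where
  "Y_differentiable f \<longleftrightarrow> (\<forall>j z. \<exists>D. has_Ypartial j f D z)"

lemma has_Ypartial_partial: "Y_differentiable f \<Longrightarrow> has_Ypartial j f (partial (Yedge j) f z) z"
  unfolding Y_differentiable_def using partial_eqI by metis

lemma Y_differentiable_add: "Y_differentiable f \<Longrightarrow> Y_differentiable g \<Longrightarrow> Y_differentiable (f + g)"
  unfolding Y_differentiable_def plus_fun_def by (blast intro: has_Ypartial_add)

lemma Y_differentiable_mult: "Y_differentiable f \<Longrightarrow> Y_differentiable g \<Longrightarrow> Y_differentiable (f * g)"
  unfolding Y_differentiable_def times_fun_def by (blast intro: has_Ypartial_mult)

lemma partial_add:
  assumes "Y_differentiable f" "Y_differentiable g"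
  shows "partial (Yedge j) (f + g) z = partial (Yedge j) f z + partial (Yedge j) g z"
  unfolding plus_fun_def
  by (rule partial_eqI[OF has_Ypartial_add[OF has_Ypartial_partial has_Ypartial_partial refl]]) fact+

lemma partial_mult:
  assumes "Y_differentiable f" "Y_differentiable g"
  shows "partial (Yedge j) (f * g) z = f z * partial (Yedge j) g z + partial (Yedge j) f z * g z"
  unfolding times_fun_def
  by (rule partial_eqI[OF has_Ypartial_mult[OF has_Ypartial_partial has_Ypartial_partial refl]]) fact+

section \<open>The shear bracket as a biderivation\<close>

lemma shear_bracket_cyclic:
  "shear_bracket f g z =
     (partial (Yedge 1) f z * partial (Yedge 2) g z - partial (Yedge 1) g z * partial (Yedge 2) f z)
   + (partial (Yedge 2) f z * partial (Yedge 3) g z - partial (Yedge 2) g z * partial (Yedge 3) f z)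
   + (partial (Yedge 3) f z * partial (Yedge 1) g z - partial (Yedge 3) g z * partial (Yedge 1) f z)"
proof -
  have "1 + 1 = (2 :: 3)" "2 + 1 = (3 :: 3)" "3 + 1 = (1 :: 3)" by simp_all
  then show ?thesis by (simp only: shear_bracket_expand sum_3)
qed

lemma shear_bracket_skew: "shear_bracket f g = - shear_bracket g f"
  by (rule ext) (simp add: shear_bracket_cyclic)

lemma shear_bracket_add_left:
  assumes "Y_differentiable f" "Y_differentiable g"
  shows "shear_bracket (f + g) h = shear_bracket f h + shear_bracket g h"
  by (rule ext) (simp add: shear_bracket_cyclic partial_add assms algebra_simps)

lemma shear_bracket_mult_left:
  assumes "Y_differentiable f" "Y_differentiable g"
  shows "shear_bracket (f * g) h = f * shear_bracket g h + shear_bracket f h * g"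
  by (rule ext) (simp add: shear_bracket_cyclic partial_mult assms algebra_simps)

text \<open>
  The bracket sees a function \<open>f\<close> only through the differences of its derivatives along the
  three spokes: simultaneous translation of all spokes is the kernel of the Poisson tensor.
\<close>

lemma shear_bracket_eq_0:
  assumes "\<And>i j z. partial (Yedge i) f z = partial (Yedge j) f z"
  shows "shear_bracket f g = 0"
proof
  show "shear_bracket f g z = 0 z" for z
    using assms[of 1 z 2] assms[of 2 z 3]
    by (simp add: shear_bracket_cyclic)
qed

text \<open>Used as coefficient ring instead of the constants because each \<open>omega i j\<close>
  is a nonconstant function that has to count as a scalar.\<close>

definition central_scalars :: "(shear \<Rightarrow> real) set" where
  "central_scalars = generated_algebra const_funs {G 1, G 2, G 3, G_inf}"

lemma central_scalars_const: "(\<lambda>z. c) \<in> central_scalars"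
  unfolding central_scalars_def const_funs_def by (rule generated_algebra.coeff) simp

lemma central_scalars_G: "G i \<in> central_scalars" "G_inf \<in> central_scalars"
  unfolding central_scalars_def using exhaust_3[of i] by (auto intro: generated_algebra.gen)

text \<open>Functions with equal derivatives along the three \<open>Y\<close> coordinates are closed
  under sums and products: perimeters have derivative 0, and \<open>G_inf\<close> depends only on
  the product of the spokes.\<close>

lemma central_scalars_partial:
  assumes "f \<in> central_scalars"
  shows "Y_differentiable f \<and> (\<forall>i j z. partial (Yedge i) f z = partial (Yedge j) f z)"
  using assms unfolding central_scalars_def
proof induction
  case (coeff f)
  then obtain c where f: "f = (\<lambda>z. c)" by (auto simp: const_funs_def)
  have "has_Ypartial j f 0 z" for j z unfolding f by (simp add: has_Ypartial_const)
  then show ?case unfolding Y_differentiable_def by (metis partial_eqI)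
next
  case (gen f)
  then consider i where "f = perimeter i" | "f = G_inf"
    unfolding G_eq by blast
  \<comment> \<open>The derivative \<open>D\<close> is chosen before the direction \<open>j\<close>,
    which is what makes the three partial derivatives coincide.\<close>
  then have "\<exists>D. \<forall>j z. has_Ypartial j f (D z) z"
  proof cases
    case 1
    then show ?thesis using has_Ypartial_perimeter[OF refl] by (intro exI[of _ "\<lambda>z. 0"]) simp
  next
    case 2
    then show ?thesis
      using has_Ypartial_G_inf
      by (intro exI[of _ "\<lambda>z. spoke 1 z * spoke 2 z * spoke 3 z - 1 / (spoke 1 z * spoke 2 z * spoke 3 z)"]) simp
  qed
  then show ?case unfolding Y_differentiable_def by (metis partial_eqI)
qed (simp_all only: Y_differentiable_add Y_differentiable_mult partial_add partial_mult, metis+)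

text \<open>The right-hand side of the generation claim; it serves as carrier until
  \<open>geodesic_algebra_eq\<close> identifies it with the algebra of all traces.\<close>

definition shear_algebra :: "(shear \<Rightarrow> real) set" where
  "shear_algebra = generated_algebra central_scalars {G_pair 1 2, G_pair 2 3, G_pair 1 3}"

lemma Y_differentiable_G_pair:
  "Y_differentiable (G_pair 1 2)" "Y_differentiable (G_pair 2 3)" "Y_differentiable (G_pair 1 3)"
  unfolding G_pair_eqs Y_differentiable_def
  by (intro allI exI; rule has_Ypartial_pair_function; simp)+

lemma shear_algebra_differentiable:
  assumes "f \<in> shear_algebra"
  shows "Y_differentiable f"
  using assms unfolding shear_algebra_def
proof induction
  case (coeff c)
  then show ?case by (simp add: central_scalars_partial)
next
  case (gen x)
  then show ?case using Y_differentiable_G_pair by blast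
qed (simp_all only: Y_differentiable_add Y_differentiable_mult)

lemma omega_eqs:
  "omega 1 2 = G 1 * G 2 + G 3 * G_inf"
  "omega 2 3 = G 2 * G 3 + G 1 * G_inf"
  "omega 1 3 = G 1 * G 3 + G 2 * G_inf"
proof -
  have "- 1 - 2 = (3 :: 3)" "- 2 - 3 = (1 :: 3)" "- 1 - 3 = (2 :: 3)" by simp_all
  then show "omega 1 2 = G 1 * G 2 + G 3 * G_inf" "omega 2 3 = G 2 * G 3 + G 1 * G_inf"
    "omega 1 3 = G 1 * G 3 + G 2 * G_inf"
    by (simp_all only: omega_def)
qed

lemma partial_pair_function:
  "i \<noteq> j \<Longrightarrow> partial (Yedge k) (pair_function i j) z =
    (if k = i then spoke i z * spoke j z - 1 / (spoke i z * spoke j z) - spoke j z / spoke i z - perimeter j z / spoke i z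
     else if k = j then spoke i z * spoke j z - 1 / (spoke i z * spoke j z) + spoke j z / spoke i z + perimeter i z * spoke j z
     else 0)"
  by (rule partial_eqI[OF has_Ypartial_pair_function])

lemma shear_bracket_G_pair:
  "shear_bracket (G_pair 1 2) (G_pair 2 3) =
     G_pair 1 2 * G_pair 2 3 - 2 * G_pair 1 3 - omega 1 3"
  "shear_bracket (G_pair 2 3) (G_pair 1 3) =
     G_pair 2 3 * G_pair 1 3 - 2 * G_pair 1 2 - omega 1 2"
  "shear_bracket (G_pair 1 3) (G_pair 1 2) =
     G_pair 1 2 * G_pair 1 3 - 2 * G_pair 2 3 - omega 2 3"
  unfolding G_pair_eqs omega_eqs G_eq G_inf_eq
  by (rule ext, simp add: shear_bracket_cyclic partial_pair_function pair_function_def,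
      simp add: field_simps)+

section \<open>Traces of the Fuchsian group and generation\<close>

lemma matfun_trace_gamma: "matfun_trace (gamma i) = - G i"
  by (rule ext) (simp add: matfun_trace_def G_def)

lemma matfun_trace_gamma_pair: "matfun_trace (gamma i \<otimes> gamma j) = - G_pair i j"
  by (rule ext) (simp add: matfun_trace_def matfun_mult_def G_pair_def)

lemma matfun_trace_gamma_triple: "matfun_trace (gamma 1 \<otimes> gamma 2 \<otimes> gamma 3) = - G_inf"
  by (rule ext) (simp add: matfun_trace_def matfun_mult_def G_inf_def)

lemma minus_one_central: "- 1 \<in> central_scalars" and one_central: "1 \<in> central_scalars"
  and zero_central: "0 \<in> central_scalars"
  using central_scalars_const[of "-1"] central_scalars_const[of 1] central_scalars_const[of 0]
  by (simp_all add: one_fun_def zero_fun_def fun_Compl_def)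

text \<open>The coefficient ring is \<open>shear_algebra\<close> itself, which contains the seven
  basic traces up to sign; \<open>trace_M3\<close> then keeps the trace of every module element
  inside it.\<close>

interpretation fuchsian: three_matrices shear_algebra "gamma 1" "gamma 2" "gamma 3"
proof
  show "(\<lambda>z. c) \<in> shear_algebra" for c
    unfolding shear_algebra_def by (rule generated_algebra.coeff[OF central_scalars_const])
  show "matfun_trace (gamma 1) \<in> shear_algebra" "matfun_trace (gamma 2) \<in> shear_algebra"
    "matfun_trace (gamma 3) \<in> shear_algebra"
    "matfun_trace (gamma 1 \<otimes> gamma 2 \<otimes> gamma 3) \<in> shear_algebra"
    unfolding shear_algebra_def matfun_trace_gamma matfun_trace_gamma_triple
    by (intro generated_algebra_uminus minus_one_central generated_algebra.coeff central_scalars_G)+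
  show "matfun_trace (gamma 1 \<otimes> gamma 2) \<in> shear_algebra"
    "matfun_trace (gamma 1 \<otimes> gamma 3) \<in> shear_algebra"
    "matfun_trace (gamma 2 \<otimes> gamma 3) \<in> shear_algebra"
    unfolding shear_algebra_def matfun_trace_gamma_pair
    by (intro generated_algebra_uminus minus_one_central generated_algebra.gen; simp)+
qed (auto simp: shear_algebra_def det_gamma intro: generated_algebra.intros)

text \<open>Determinant 1 is carried through the induction because the inverse is trace minus matrix
  only in that case.\<close>

lemma Delta04_det_module:
  assumes "X \<in> Delta04"
  shows "(\<forall>z. det (X z) = 1) \<and> X \<in> fuchsian.M3"
  using assms
proof induction
  case one
  show ?case using fuchsian.one_M3 by (simp add: matfun_one_def)
next
  case (gen i)
  show ?case using exhaust_3[of i] fuchsian.gens_M3 det_gamma by metis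
next
  case (mult X Y)
  then show ?case using fuchsian.mult_M3[of X Y] by (simp add: det_mul matfun_mult_def)
next
  case (inv X)
  have eq: "(\<lambda>z. matrix_inv (X z)) = matfun_trace X \<odot> matfun_one + - 1 \<odot> X"
    using inv by (simp add: fun_eq_iff matrix_inv_2 matfun_trace_def matfun_scale_def matfun_one_def)
  have "(\<lambda>z. matrix_inv (X z)) \<in> fuchsian.M3"
    unfolding eq
    using inv fuchsian.module_M(4) fuchsian.one_M3 fuchsian.trace_M3[of X] fuchsian.T_minus_one
    unfolding matfun_module_def by blast
  then show ?case using inv by (simp add: det_matrix_inv_2)
qed

lemma geodesic_trace: "X \<in> Delta04 \<Longrightarrow> - matfun_trace X \<in> geodesic_algebra"
  unfolding geodesic_algebra_def matfun_trace_def
  by (rule generated_algebra_uminus)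
    (auto simp: const_funs_def one_fun_def fun_Compl_def intro!: generated_algebra.gen)

text \<open>Every word lies in the module \<open>M3\<close>, so its trace lies in
  \<open>shear_algebra\<close>; conversely each generator of \<open>shear_algebra\<close> is minus
  the trace of a word.\<close>

lemma geodesic_algebra_eq: "geodesic_algebra = shear_algebra"
proof
  have "(\<lambda>z. trace (X z)) \<in> shear_algebra" if "X \<in> Delta04" for X
    using Delta04_det_module[OF that] fuchsian.trace_M3 unfolding matfun_trace_def by blast
  then show "geodesic_algebra \<subseteq> shear_algebra"
    using fuchsian.T_const unfolding geodesic_algebra_def shear_algebra_def const_funs_def
    by (intro generated_algebra_subset) blast+
  have pair: "gamma i \<otimes> gamma j \<in> Delta04" for i j
    unfolding matfun_mult_def by (intro Delta04.intros)
  have triple: "gamma 1 \<otimes> gamma 2 \<otimes> gamma 3 \<in> Delta04"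
    unfolding matfun_mult_def by (intro Delta04.intros)
  have G: "G i \<in> geodesic_algebra" "G_pair i j \<in> geodesic_algebra" "G_inf \<in> geodesic_algebra" for i j
    using geodesic_trace[OF Delta04.gen[of i]] geodesic_trace[OF pair[of i j]] geodesic_trace[OF triple]
    by (simp_all add: matfun_trace_gamma matfun_trace_gamma_pair matfun_trace_gamma_triple)
  have const: "const_funs \<subseteq> geodesic_algebra"
    unfolding geodesic_algebra_def by (auto intro: generated_algebra.coeff)
  have "central_scalars \<subseteq> geodesic_algebra"
    using G const unfolding central_scalars_def geodesic_algebra_def
    by (intro generated_algebra_subset) auto
  then show "shear_algebra \<subseteq> geodesic_algebra"
    using G unfolding shear_algebra_def geodesic_algebra_def
    by (intro generated_algebra_subset) auto
qed

lemma omega_central: "omega i j \<in> central_scalars"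
  unfolding omega_def central_scalars_def
  by (intro generated_algebra.add generated_algebra.mult central_scalars_G[unfolded central_scalars_def])

text \<open>The Jacobi identity for geodesic functions comes out of this algebraically, with no
  second derivatives: the explicit brackets close on the generators, and the scalars are
  central.\<close>

interpretation geodesic: cyclic_bracket central_scalars shear_algebra shear_bracket
  "G_pair 1 2" "G_pair 2 3" "G_pair 1 3" "omega 1 2" "omega 2 3" "omega 1 3"
proof
  let ?S = "{G_pair 1 2, G_pair 2 3, G_pair 1 3}"
  show "shear_algebra = generated_algebra central_scalars ?S"
    by (rule shear_algebra_def)
  have self: "shear_bracket f f = 0" for f
    by (rule ext) (simp add: shear_bracket_cyclic)
  have G: "s \<in> shear_algebra" if "s \<in> ?S" for s
    using that unfolding shear_algebra_def by (rule generated_algebra.gen)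
  have K: "f \<in> shear_algebra" if "f \<in> central_scalars" for f
    using that unfolding shear_algebra_def by (rule generated_algebra.coeff)
  have formulae: "shear_bracket (G_pair 1 2) (G_pair 2 3) \<in> shear_algebra"
    "shear_bracket (G_pair 2 3) (G_pair 1 3) \<in> shear_algebra"
    "shear_bracket (G_pair 1 3) (G_pair 1 2) \<in> shear_algebra"
    unfolding shear_bracket_G_pair mult_2
    by (intro fuchsian.T_diff fuchsian.T_mult fuchsian.T_add G K omega_central; simp)+
  have neg: "- f \<in> shear_algebra" if "f \<in> shear_algebra" for f
    using generated_algebra_uminus[OF minus_one_central] that unfolding shear_algebra_def by blast
  show "skew_biderivation_on central_scalars shear_algebra shear_bracket"
    unfolding shear_algebra_def
  proof (rule skew_biderivation_onI)
    fix s t assume "s \<in> ?S" "t \<in> ?S"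
    then show "shear_bracket s t \<in> generated_algebra central_scalars ?S"
      unfolding shear_algebra_def[symmetric]
      using formulae neg[OF formulae(1)] neg[OF formulae(2)] neg[OF formulae(3)]
        fuchsian.T_zero
      by (elim insertE emptyE) (simp_all add: self shear_bracket_skew[symmetric])
  next
    show "shear_bracket c f = 0" if "c \<in> central_scalars" for c f
      using central_scalars_partial[OF that] by (intro shear_bracket_eq_0) blast
  qed (auto intro: shear_bracket_skew shear_bracket_add_left shear_bracket_mult_left
      shear_algebra_differentiable simp: shear_algebra_def[symmetric] zero_central minus_one_central)
  show "x = 0" if "x + x = 0" for x :: "shear \<Rightarrow> real"
    using that by (auto simp: fun_eq_iff)
qed (simp_all add: one_central minus_one_central omega_central shear_bracket_G_pair)

text \<open>Linearity over \<open>central_scalars\<close> contains linearity over the constants, so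
  the coefficient ring can be shrunk.\<close>

lemma poisson_algebra_geodesic: "poisson_algebra_on const_funs geodesic_algebra shear_bracket"
proof -
  have "c \<in> central_scalars" if "c \<in> const_funs" for c
    using that unfolding central_scalars_def by (rule generated_algebra.coeff)
  then show ?thesis
    using geodesic.biderivation geodesic.jacobi
    unfolding geodesic_algebra_eq poisson_algebra_on_def skew_biderivation_on_def by blast
qed

lemma central_G:
  assumes "c \<in> {G 1, G 2, G 3, G_inf}"
  shows "poisson_central geodesic_algebra shear_bracket c"
  using assms central_scalars_G geodesic.K_A geodesic.br_scalar_left
  unfolding poisson_central_def geodesic_algebra_eq by blast

theorem theorem2p1:
  shows
    "poisson_algebra_on const_funs geodesic_algebra shear_bracket \<and>
     (\<forall>c \<in> {G 1, G 2, G 3, G_inf}. poisson_central geodesic_algebra shear_bracket c) \<and>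
     geodesic_algebra =
       generated_algebra (generated_algebra const_funs {G 1, G 2, G 3, G_inf})
         {G_pair 1 2, G_pair 2 3, G_pair 1 3} \<and>
     shear_bracket (G_pair 1 2) (G_pair 2 3) =
       G_pair 1 2 * G_pair 2 3 - 2 * G_pair 1 3 - omega 1 3 \<and>
     shear_bracket (G_pair 2 3) (G_pair 1 3) =
       G_pair 2 3 * G_pair 1 3 - 2 * G_pair 1 2 - omega 1 2 \<and>
     shear_bracket (G_pair 1 3) (G_pair 1 2) =
       G_pair 1 2 * G_pair 1 3 - 2 * G_pair 2 3 - omega 2 3 \<and>
     (\<forall>\<omega>12 \<omega>23 \<omega>13 :: 'k::field_char_0.
       let g12 = indet L12; g23 = indet L23; g13 = indet L13;
           w12 = const_poly \<omega>12; w23 = const_poly \<omega>23; w13 = const_poly \<omega>13;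
           C = g12^2 + g23^2 + g13^2 - g12 * g23 * g13 + g12 * w12 + g23 * w23 + g13 * w13;
           defined_by_formulae = (\<lambda>br.
             skew_biderivation_on (range const_poly) UNIV br \<and>
             br g12 g23 = g12 * g23 - 2 * g13 - w13 \<and>
             br g23 g13 = g23 * g13 - 2 * g12 - w12 \<and>
             br g13 g12 = g12 * g13 - 2 * g23 - w23)
       in (\<exists>!br. defined_by_formulae br) \<and>
          (\<forall>br. defined_by_formulae br \<longrightarrow>
             poisson_algebra_on (range const_poly) UNIV br \<and>
             poisson_central UNIV br C))"
proof -
  have generated: "geodesic_algebra =
    generated_algebra (generated_algebra const_funs {G 1, G 2, G 3, G_inf})
      {G_pair 1 2, G_pair 2 3, G_pair 1 3}"
    unfolding geodesic_algebra_eq shear_algebra_def central_scalars_def ..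
  show ?thesis
    unfolding Let_def poly3_formulae_def[symmetric]
    by (intro conjI allI impI ballI poisson_algebra_geodesic central_G generated
        shear_bracket_G_pair poly3_formulae_ex1 poly3_formulae_poisson)
qed

end
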